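(* Let $\mathcal D$ be a directed acyclic graph with finite vertex set $V$ and let $\rho\in\mathbb S_1^+(\mathcal H_V)$. Then the excess global information $$gI(\mathcal D)_\rho=\sum_{v\in V}\operatorname S(v\mid\operatorname{pa}(v))_\rho-\operatorname S(V)_\rho$$ satisfies $gI(\mathcal D)_\rho\ge 0$. Consequently, $gI(\mathcal D)_\rho=0$ if and only if $\rho$ satisfies any one, and hence all, of the directed Markov properties (O), (L) and (G).
   Context: For each $v\in V$, $\mathcal H_v$ is a finite-dimensional complex Hilbert space; $\mathcal H_A=\bigotimes_{v\in A}\mathcal H_v$ for $A\subseteq V$, with $\mathcal H_\varnothing=\mathbb C$. $\mathbb S_1^+(\mathcal H_A)$ is the set of positive definite (self-adjoint) operators on $\mathcal H_A$ of trace one. For $A\subseteq V$, $\rho_A=\operatorname{Tr}_{V\setminus A}(\rho)$ is the marginal. The von Neumann entropy is $\operatorname S(A)_\rho=-\operatorname{Tr}(\rho_A\log\rho_A)$, with $\operatorname S(\varnothing)_\rho=0$; for disjoint $A,B$, the conditional entropy is $\operatorname S(A\mid B)_\rho=\operatorname S(A\cup B)_\rho-\operatorname S(B)_\rho$. For pairwise disjoint $A,B,C\subseteq V$, $$I(A:B\mid C)_\rho=\operatorname S(A\cup C)_\rho+\operatorname S(B\cup C)_\rho-\operatorname S(C)_\rho-\operatorname S(A\cup B\cup C)_\rho,$$ and $A\perp\!\!\!\perp_Q B\mid C$ means $I(A:B\mid C)_\rho=0$. A vertex $v$ is identified with $\{v\}$. For a vertex $v$ of $\mathcal D$: $\operatorname{pa}(v)$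 is its set of parents, $\operatorname{de}(v)$ its set of descendants (excluding $v$), $\operatorname{nd}(v)=V\setminus(\{v\}\cup\operatorname{de}(v))$. A total ordering $<$ of $V$ is topological if $u<w$ for every arrow $u\to w$; $\operatorname{pr}(v)=\{u\in V:u<v\}$. A walk (repeated vertices allowed, arrows traversable in either direction) has a collider at a non-endpoint $\alpha_i$ if $\alpha_{i-1}\to\alpha_i\leftarrow\alpha_{i+1}$. A walk is active relative to $S$ if every non-collider on it is outside $S$ and every collider on it is in $S$; otherwise it is blocked by $S$. Disjoint $A,B$ are $d$-separated by $S$ if every walk from $A$ to $B$ is blocked by $S$. Directed Markov properties of $\rho$: (O), relative to a given topological ordering: $v\perp\!\!\!\perp_Q(\operatorname{pr}(v)\setminus\operatorname{pa}(v))\mid\operatorname{pa}(v)$ for all $v\in V$. (L): $v\perp\!\!\!\perp_Q(\operatorname{nd}(v)\setminus\operatorname{pa}(v))\mid\operatorname{pa}(v)$ for all $v\in V$. (G): for all pairwise disjoint $A,B,S\subseteq V$, if $A,B$ are $d$-separated by $S$ then $A\perp\!\!\!\perp_Q B\mid S$. *)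

theory Defs
  imports Complex_Main "HOL-Library.FuncSet"
begin

section \<open>Finite-dimensional Hilbert spaces and operators\<close>

text \<open>
  The Hilbert space at a vertex \<open>v\<close> is \<open>\<complex>\<^sup>n\<close> with \<open>n = d v\<close>, given by its standard orthonormal
  basis \<open>{..<d v}\<close>.  The tensor product over \<open>A\<close> then has the product basis \<open>cfg d A\<close>, for which
  \<open>cfg d {}\<close> is a singleton, i.e. the empty tensor product is \<open>\<complex>\<close>.  Vectors and operators on the
  space with finite orthonormal basis \<open>X\<close> are represented by their coordinates and matrix entries;
  these are required to vanish outside \<open>X\<close>, which makes the representation unique.
\<close>

definition cfg :: "('v \<Rightarrow> nat) \<Rightarrow> 'v set \<Rightarrow> ('v \<Rightarrow> nat) set" where
  "cfg d A = (\<Pi>\<^sub>E v\<in>A. {..<d v})"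

definition vecs :: "'x set \<Rightarrow> ('x \<Rightarrow> complex) set" where
  "vecs X = {u. \<forall>x. x \<notin> X \<longrightarrow> u x = 0}"

definition ops :: "'x set \<Rightarrow> ('x \<Rightarrow> 'x \<Rightarrow> complex) set" where
  "ops X = {M. \<forall>x y. x \<notin> X \<or> y \<notin> X \<longrightarrow> M x y = 0}"

definition op_apply :: "'x set \<Rightarrow> ('x \<Rightarrow> 'x \<Rightarrow> complex) \<Rightarrow> ('x \<Rightarrow> complex) \<Rightarrow> 'x \<Rightarrow> complex" where
  "op_apply X M u = (\<lambda>x. \<Sum>y\<in>X. M x y * u y)"

definition op_mult ::
  "'x set \<Rightarrow> ('x \<Rightarrow> 'x \<Rightarrow> complex) \<Rightarrow> ('x \<Rightarrow> 'x \<Rightarrow> complex) \<Rightarrow> 'x \<Rightarrow> 'x \<Rightarrow> complex" where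
  "op_mult X M N = (\<lambda>x y. \<Sum>z\<in>X. M x z * N z y)"

definition op_trace :: "'x set \<Rightarrow> ('x \<Rightarrow> 'x \<Rightarrow> complex) \<Rightarrow> complex" where
  "op_trace X M = (\<Sum>x\<in>X. M x x)"

definition op_inner :: "'x set \<Rightarrow> ('x \<Rightarrow> complex) \<Rightarrow> ('x \<Rightarrow> complex) \<Rightarrow> complex" where
  "op_inner X u w = (\<Sum>x\<in>X. cnj (u x) * w x)"

definition self_adjoint :: "('x \<Rightarrow> 'x \<Rightarrow> complex) \<Rightarrow> bool" where
  "self_adjoint M \<longleftrightarrow> (\<forall>x y. M y x = cnj (M x y))"

definition positive_definite :: "'x set \<Rightarrow> ('x \<Rightarrow> 'x \<Rightarrow> complex) \<Rightarrow> bool" where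
  "positive_definite X M \<longleftrightarrow> self_adjoint M \<and>
     (\<forall>u\<in>vecs X. u \<noteq> (\<lambda>x. 0) \<longrightarrow> Re (op_inner X u (op_apply X M u)) > 0)"

definition pos_states :: "'x set \<Rightarrow> ('x \<Rightarrow> 'x \<Rightarrow> complex) set" where
  "pos_states X = {M \<in> ops X. positive_definite X M \<and> op_trace X M = 1}"

text \<open>
  Spectral functional calculus: for a self-adjoint \<open>M\<close> on a finite basis, \<open>op_fun X f M\<close> is the
  operator acting as the scalar \<open>f \<mu>\<close> on the \<open>\<mu>\<close>-eigenspace of \<open>M\<close>, for every \<open>\<mu>\<close>.  It exists and
  is unique because the space is the orthogonal sum of the eigenspaces, all for real eigenvalues.
\<close>

definition op_fun ::
  "'x set \<Rightarrow> (real \<Rightarrow> real) \<Rightarrow> ('x \<Rightarrow> 'x \<Rightarrow> complex) \<Rightarrow> 'x \<Rightarrow> 'x \<Rightarrow> complex" where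
  "op_fun X f M = (THE L. L \<in> ops X \<and>
     (\<forall>\<mu>::real. \<forall>u\<in>vecs X.
        op_apply X M u = (\<lambda>x. of_real \<mu> * u x) \<longrightarrow>
        op_apply X L u = (\<lambda>x. of_real (f \<mu>) * u x)))"

abbreviation op_log :: "'x set \<Rightarrow> ('x \<Rightarrow> 'x \<Rightarrow> complex) \<Rightarrow> 'x \<Rightarrow> 'x \<Rightarrow> complex" where
  "op_log X \<equiv> op_fun X ln"


section \<open>Marginals, entropy and conditional independence\<close>

text \<open>
  Partial trace over \<open>V - A\<close>; \<open>override_on z x A\<close> is the configuration of \<open>V\<close> that agrees with
  \<open>x\<close> on \<open>A\<close> and with \<open>z\<close> on \<open>V - A\<close>.
\<close>

definition marginal ::
  "('v \<Rightarrow> nat) \<Rightarrow> 'v set \<Rightarrow> (('v \<Rightarrow> nat) \<Rightarrow> ('v \<Rightarrow> nat) \<Rightarrow> complex) \<Rightarrow> 'v set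
     \<Rightarrow> ('v \<Rightarrow> nat) \<Rightarrow> ('v \<Rightarrow> nat) \<Rightarrow> complex" where
  "marginal d V \<rho> A = (\<lambda>x y. if x \<in> cfg d A \<and> y \<in> cfg d A
     then \<Sum>z\<in>cfg d (V - A). \<rho> (override_on z x A) (override_on z y A) else 0)"

text \<open>
  The trace below is real for states, so taking the real part only changes the type.  On \<open>A = {}\<close>
  the marginal of a state is the scalar 1, whose entropy is 0.
\<close>

definition entropy ::
  "('v \<Rightarrow> nat) \<Rightarrow> 'v set \<Rightarrow> (('v \<Rightarrow> nat) \<Rightarrow> ('v \<Rightarrow> nat) \<Rightarrow> complex) \<Rightarrow> 'v set \<Rightarrow> real" where
  "entropy d V \<rho> A =
     - Re (op_trace (cfg d A)
         (op_mult (cfg d A) (marginal d V \<rho> A) (op_log (cfg d A) (marginal d V \<rho> A))))"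

definition cond_entropy ::
  "('v \<Rightarrow> nat) \<Rightarrow> 'v set \<Rightarrow> (('v \<Rightarrow> nat) \<Rightarrow> ('v \<Rightarrow> nat) \<Rightarrow> complex) \<Rightarrow> 'v set \<Rightarrow> 'v set \<Rightarrow> real"
  where
  "cond_entropy d V \<rho> A B = entropy d V \<rho> (A \<union> B) - entropy d V \<rho> B"

definition cond_mutual_info ::
  "('v \<Rightarrow> nat) \<Rightarrow> 'v set \<Rightarrow> (('v \<Rightarrow> nat) \<Rightarrow> ('v \<Rightarrow> nat) \<Rightarrow> complex)
     \<Rightarrow> 'v set \<Rightarrow> 'v set \<Rightarrow> 'v set \<Rightarrow> real" where
  "cond_mutual_info d V \<rho> A B C =
     entropy d V \<rho> (A \<union> C) + entropy d V \<rho> (B \<union> C)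
       - entropy d V \<rho> C - entropy d V \<rho> (A \<union> B \<union> C)"

definition q_indep ::
  "('v \<Rightarrow> nat) \<Rightarrow> 'v set \<Rightarrow> (('v \<Rightarrow> nat) \<Rightarrow> ('v \<Rightarrow> nat) \<Rightarrow> complex)
     \<Rightarrow> 'v set \<Rightarrow> 'v set \<Rightarrow> 'v set \<Rightarrow> bool" where
  "q_indep d V \<rho> A B C \<longleftrightarrow> cond_mutual_info d V \<rho> A B C = 0"


section \<open>Directed acyclic graphs and d-separation\<close>

text \<open>A graph on \<open>V\<close> is its arrow relation \<open>E\<close>, where \<open>(u, w) \<in> E\<close> means \<open>u \<rightarrow> w\<close>.\<close>

definition is_dag :: "'v set \<Rightarrow> ('v \<times> 'v) set \<Rightarrow> bool" where
  "is_dag V E \<longleftrightarrow> finite V \<and> E \<subseteq> V \<times> V \<and> acyclic E"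

definition pa :: "('v \<times> 'v) set \<Rightarrow> 'v \<Rightarrow> 'v set" where
  "pa E v = {u. (u, v) \<in> E}"

definition de :: "('v \<times> 'v) set \<Rightarrow> 'v \<Rightarrow> 'v set" where
  "de E v = {w. (v, w) \<in> E\<^sup>+} - {v}"

definition nd :: "'v set \<Rightarrow> ('v \<times> 'v) set \<Rightarrow> 'v \<Rightarrow> 'v set" where
  "nd V E v = V - ({v} \<union> de E v)"

text \<open>A total ordering of \<open>V\<close> is given by its strict order relation.\<close>

definition topological_ordering ::
  "'v set \<Rightarrow> ('v \<times> 'v) set \<Rightarrow> ('v \<times> 'v) set \<Rightarrow> bool" where
  "topological_ordering V E r \<longleftrightarrow> r \<subseteq> V \<times> V \<and> strict_linear_order_on V r \<and> E \<subseteq> r"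

definition pr :: "('v \<times> 'v) set \<Rightarrow> 'v \<Rightarrow> 'v set" where
  "pr r v = {u. (u, v) \<in> r}"

text \<open>
  In an acyclic graph two vertices are joined by at most one arrow, so a walk is determined by its
  list of vertices.  Colliders are positions in this list, since vertices may be repeated.
\<close>

definition is_walk :: "('v \<times> 'v) set \<Rightarrow> 'v list \<Rightarrow> bool" where
  "is_walk E p \<longleftrightarrow> p \<noteq> [] \<and> successively (\<lambda>u w. (u, w) \<in> E \<or> (w, u) \<in> E) p"

definition collider_at :: "('v \<times> 'v) set \<Rightarrow> 'v list \<Rightarrow> nat \<Rightarrow> bool" where
  "collider_at E p i \<longleftrightarrow> 0 < i \<and> i + 1 < length p \<and>
     (p ! (i - 1), p ! i) \<in> E \<and> (p ! (i + 1), p ! i) \<in> E"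

definition active_walk :: "('v \<times> 'v) set \<Rightarrow> 'v set \<Rightarrow> 'v list \<Rightarrow> bool" where
  "active_walk E S p \<longleftrightarrow> (\<forall>i < length p. if collider_at E p i then p ! i \<in> S else p ! i \<notin> S)"

definition d_separated :: "('v \<times> 'v) set \<Rightarrow> 'v set \<Rightarrow> 'v set \<Rightarrow> 'v set \<Rightarrow> bool" where
  "d_separated E A B S \<longleftrightarrow>
     (\<forall>p. is_walk E p \<and> hd p \<in> A \<and> last p \<in> B \<longrightarrow> \<not> active_walk E S p)"


section \<open>Markov properties and the excess global information\<close>

definition ordered_markov where
  "ordered_markov d V E \<rho> r \<longleftrightarrow>
     (\<forall>v\<in>V. q_indep d V \<rho> {v} (pr r v - pa E v) (pa E v))"

definition local_markov where
  "local_markov d V E \<rho> \<longleftrightarrow>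
     (\<forall>v\<in>V. q_indep d V \<rho> {v} (nd V E v - pa E v) (pa E v))"

definition global_markov where
  "global_markov d V E \<rho> \<longleftrightarrow>
     (\<forall>A B S. A \<subseteq> V \<and> B \<subseteq> V \<and> S \<subseteq> V \<and> A \<inter> B = {} \<and> A \<inter> S = {} \<and> B \<inter> S = {} \<and>
        d_separated E A B S \<longrightarrow> q_indep d V \<rho> A B S)"

definition excess_global_info ::
  "('v \<Rightarrow> nat) \<Rightarrow> 'v set \<Rightarrow> ('v \<times> 'v) set \<Rightarrow> (('v \<Rightarrow> nat) \<Rightarrow> ('v \<Rightarrow> nat) \<Rightarrow> complex) \<Rightarrow> real"
  where
  "excess_global_info d V E \<rho> =
     (\<Sum>v\<in>V. cond_entropy d V \<rho> {v} (pa E v)) - entropy d V \<rho> V"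

end

theory Submission
  imports Defs "HOL-Analysis.Analysis"
begin

text \<open>
  Strong subadditivity of the entropy makes every conditional mutual information nonnegative.  Along
  a topological ordering the chain rule turns the excess global information into
  \<open>\<Sum>v. I(v : pr(v) - pa(v) | pa(v))\<close>, a sum of nonnegative terms that vanishes iff (O) holds.
  The remaining implications are (O) to (G), by induction on the vertices using only the semigraphoid
  rules, then (G) to (L) and (L) to (O).

  Strong subadditivity is monotonicity of the relative entropy of \<open>\<rho>\<^sub>A\<^sub>B\<^sub>C\<close> and \<open>1 \<otimes> \<rho>\<^sub>B\<^sub>C\<close> under the
  partial trace over \<open>C\<close>.  In eigenbases of \<open>\<rho>\<close> and \<open>\<sigma>\<close> with overlaps \<open>w\<close>, the relative entropy is
  \<open>\<Sum>j k. |w j k|\<^sup>2 p j (ln (p j) - ln (q k))\<close>.  Up to a term depending only on the trace of \<open>\<rho>\<close> it is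
  the increment from \<open>t = 0\<close> to \<open>t = \<infinity>\<close> of \<open>\<Sum>j k. |w j k|\<^sup>2 p j ln (q k + t p j)\<close>, whose derivative
  is the resolvent sum \<open>\<Sum>j k. |w j k|\<^sup>2 (p j)\<^sup>2 / (q k + t p j)\<close>.  The latter is the maximum over
  operators \<open>K\<close> of a form in \<open>K\<close> that depends linearly on \<open>\<rho>\<close> and \<open>\<sigma>\<close>; as \<open>K\<close> on the smaller space
  may be replaced by \<open>K \<otimes> 1\<close> on the larger one, it decreases under partial traces.
\<close>

section \<open>Spectral theorem and functional calculus\<close>

text \<open>
  The basis is indexed by \<open>X\<close> itself, so that orthonormality forces it to be complete.  Only entries
  on \<open>X\<close> matter: \<open>\<phi> j\<close> need not be in \<open>vecs X\<close>, nor \<open>M\<close> in \<open>ops X\<close>.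
\<close>
definition eigenbasis :: "'x set \<Rightarrow> ('x \<Rightarrow> 'x \<Rightarrow> complex) \<Rightarrow> ('x \<Rightarrow> 'x \<Rightarrow> complex) \<Rightarrow> ('x \<Rightarrow> real) \<Rightarrow> bool"
  where "eigenbasis X M \<phi> \<mu> \<longleftrightarrow>
    (\<forall>i\<in>X. \<forall>j\<in>X. op_inner X (\<phi> i) (\<phi> j) = (if i = j then 1 else 0)) \<and>
    (\<forall>j\<in>X. \<forall>x\<in>X. op_apply X M (\<phi> j) x = of_real (\<mu> j) * \<phi> j x)"

section \<open>Inner products and operators in coordinates\<close>

lemma op_inner_add_right: "op_inner X u (\<lambda>x. v x + w x) = op_inner X u v + op_inner X u w"
  by (simp add: op_inner_def algebra_simps sum.distrib)

lemma op_inner_diff_right: "op_inner X u (\<lambda>x. v x - w x) = op_inner X u v - op_inner X u w"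
  by (simp add: op_inner_def algebra_simps sum_subtractf)

lemma op_inner_scale_right: "op_inner X u (\<lambda>x. c * w x) = c * op_inner X u w"
  by (simp add: op_inner_def algebra_simps sum_distrib_left)

lemma op_inner_sum_right: "op_inner X u (\<lambda>x. \<Sum>j\<in>J. f j x) = (\<Sum>j\<in>J. op_inner X u (f j))"
  unfolding op_inner_def sum_distrib_left by (rule sum.swap)

lemma op_inner_cnj: "cnj (op_inner X u w) = op_inner X w u"
  by (simp add: op_inner_def mult.commute)

lemma op_inner_self: "op_inner X u u = of_real (\<Sum>x\<in>X. (cmod (u x))\<^sup>2)"
  by (simp add: op_inner_def complex_norm_square[symmetric] mult.commute del: of_real_power)

lemma op_inner_self_eq_0:
  assumes "finite X"
  shows "Re (op_inner X u u) = 0 \<longleftrightarrow> (\<forall>x\<in>X. u x = 0)"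
  using assms by (simp add: op_inner_self sum_nonneg_eq_0_iff)

lemma op_inner_cong: "(\<And>x. x \<in> X \<Longrightarrow> u x = u' x) \<Longrightarrow> (\<And>x. x \<in> X \<Longrightarrow> w x = w' x) \<Longrightarrow>
   op_inner X u w = op_inner X u' w'"
  by (simp add: op_inner_def)

lemma op_inner_apply_self_adjoint:
  assumes "self_adjoint M"
  shows "op_inner X u (op_apply X M w) = op_inner X (op_apply X M u) w"
proof -
  have c: "cnj (M x y) = M y x" for x y using assms unfolding self_adjoint_def by metis
  have "op_inner X u (op_apply X M w) = (\<Sum>x\<in>X. \<Sum>y\<in>X. cnj (u x) * (M x y * w y))"
    by (simp add: op_inner_def op_apply_def sum_distrib_left)
  also have "\<dots> = (\<Sum>y\<in>X. \<Sum>x\<in>X. cnj (u x) * (M x y * w y))"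
    by (rule sum.swap)
  also have "\<dots> = op_inner X (op_apply X M u) w"
    by (simp add: op_inner_def op_apply_def sum_distrib_right c) (simp add: mult_ac)
  finally show ?thesis .
qed

lemma op_apply_add: "op_apply X M (\<lambda>x. u x + w x) = (\<lambda>x. op_apply X M u x + op_apply X M w x)"
  by (simp add: op_apply_def algebra_simps sum.distrib)

lemma op_apply_scale: "op_apply X M (\<lambda>x. c * w x) = (\<lambda>x. c * op_apply X M w x)"
  by (simp add: op_apply_def algebra_simps sum_distrib_left)

lemma op_apply_vecs: "M \<in> ops X \<Longrightarrow> op_apply X M u \<in> vecs X"
  by (simp add: op_apply_def vecs_def ops_def)

section \<open>Orthonormal families and completeness\<close>

text \<open>Pythagoras: \<open>v\<close> is what remains of the standard basis vector at
  \<open>x\<close> after projection onto the span of the \<open>\<phi> j\<close>, and this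
  projection has coefficients \<open>cnj (\<phi> j x)\<close>.\<close>

lemma residual_norm:
  assumes fX: "finite X" "x \<in> X" "finite J"
    and on: "\<And>i j. i \<in> J \<Longrightarrow> j \<in> J \<Longrightarrow> op_inner X (\<phi> i) (\<phi> j) = (if i = j then 1 else 0)"
  defines "v \<equiv> \<lambda>y. (if y = x then 1 else 0) - (\<Sum>j\<in>J. cnj (\<phi> j x) * \<phi> j y)"
  shows "\<And>i. i \<in> J \<Longrightarrow> op_inner X (\<phi> i) v = 0"
    and "op_inner X v v = of_real (1 - (\<Sum>j\<in>J. (cmod (\<phi> j x))\<^sup>2))"
proof -
  have e: "op_inner X u (\<lambda>y. if y = x then 1 else 0) = cnj (u x)" for u
    using fX by (simp add: op_inner_def if_distrib cong: if_cong)
  show orth: "op_inner X (\<phi> i) v = 0" if "i \<in> J" for i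
    using that fX unfolding v_def op_inner_diff_right op_inner_sum_right op_inner_scale_right e
    by (simp add: on if_distrib cong: if_cong)
  have orth': "op_inner X v (\<phi> i) = 0" if "i \<in> J" for i
    using orth[OF that] by (metis op_inner_cnj complex_cnj_zero)
  have "op_inner X v v = cnj (v x) - (\<Sum>j\<in>J. cnj (\<phi> j x) * op_inner X v (\<phi> j))"
    by (subst (2) v_def) (simp only: op_inner_diff_right op_inner_sum_right op_inner_scale_right e)
  also have "\<dots> = cnj (v x)" by (simp add: orth')
  also have "\<dots> = of_real (1 - (\<Sum>j\<in>J. (cmod (\<phi> j x))\<^sup>2))"
    by (simp add: v_def complex_norm_square[symmetric] del: of_real_power)
  finally show "op_inner X v v = of_real (1 - (\<Sum>j\<in>J. (cmod (\<phi> j x))\<^sup>2))" .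
qed

text \<open>Double counting of the squared entries, by coordinate and by vector. It compares the
  size of an orthonormal family with \<open>card X\<close> and so takes the place of dimension
  arguments.\<close>

lemma sum_cmod_orthonormal:
  assumes "\<And>j. j \<in> J \<Longrightarrow> op_inner X (\<phi> j) (\<phi> j) = 1"
  shows "(\<Sum>x\<in>X. \<Sum>j\<in>J. (cmod (\<phi> j x))\<^sup>2) = of_nat (card J)"
proof -
  have "(\<Sum>x\<in>X. (cmod (\<phi> j x))\<^sup>2) = 1" if "j \<in> J" for j
    using assms[OF that] unfolding op_inner_self by (simp only: of_real_eq_1_iff)
  then show ?thesis by (subst sum.swap) simp
qed

text \<open>The residuals of all standard basis vectors have nonnegative squared norms, whose sum is
  \<open>card X - card X\<close> by double counting. Hence every residual vanishes, and this is the
  completeness relation.\<close>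

lemma orthonormal_complete:
  assumes fX: "finite X"
    and on: "\<And>i j. i \<in> X \<Longrightarrow> j \<in> X \<Longrightarrow> op_inner X (\<phi> i) (\<phi> j) = (if i = j then 1 else 0)"
    and x: "x \<in> X" and y: "y \<in> X"
  shows "(\<Sum>j\<in>X. \<phi> j x * cnj (\<phi> j y)) = (if x = y then 1 else 0)"
proof -
  define v where "v = (\<lambda>x y. (if y = x then 1 else 0) - (\<Sum>j\<in>X. cnj (\<phi> j x) * \<phi> j y))"
  have n: "Re (op_inner X (v z) (v z)) = 1 - (\<Sum>j\<in>X. (cmod (\<phi> j z))\<^sup>2)" if "z \<in> X" for z
    unfolding v_def using residual_norm(2)[OF fX that fX on] by simp
  have ge: "Re (op_inner X (v z) (v z)) \<ge> 0" for z
    by (simp add: op_inner_self sum_nonneg)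
  have "(\<Sum>z\<in>X. Re (op_inner X (v z) (v z))) = 0"
    using sum_cmod_orthonormal[of X X \<phi>] on by (simp add: n sum_subtractf)
  then have "Re (op_inner X (v y) (v y)) = 0"
    using ge y fX by (subst (asm) sum_nonneg_eq_0_iff) auto
  then have "v y x = 0" using x fX by (simp add: op_inner_self_eq_0)
  then show ?thesis by (auto simp: v_def mult.commute)
qed

section \<open>Eigenvectors from the Rayleigh quotient\<close>

text \<open>For small positive \<open>s\<close> a nonzero linear term would dominate the quadratic
  one. This is the first-order condition at a maximizer.\<close>

lemma quadratic_nonpos_imp_zero:
  fixes a b :: real
  assumes "a \<ge> 0" and "\<And>s. 2 * s * a + s\<^sup>2 * b \<le> 0"
  shows "a = 0"
proof (rule ccontr)
  assume "a \<noteq> 0"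
  then have a: "a > 0" using assms(1) by simp
  \<comment> \<open>The choice gives \<open>s * \<bar>b\<bar> < a\<close>, which keeps
    \<open>2 * a + s * b\<close> positive.\<close>
  define s where "s = a / (\<bar>b\<bar> + 1)"
  have s: "s > 0" using a by (simp add: s_def)
  have "s * \<bar>b\<bar> < a" using a by (simp add: s_def divide_simps)
  moreover have "s * (- b) \<le> s * \<bar>b\<bar>" using s by (intro mult_left_mono) auto
  ultimately have "2 * a + s * b > 0" using a by simp
  then have "s * (2 * a + s * b) > 0" using s by simp
  then show False using assms(2)[of s] by (simp add: power2_eq_square algebra_simps)
qed

text \<open>Functions carry the product topology, and the set is closed in a product of unit discs
  over \<open>X\<close> and of \<open>{0}\<close> elsewhere, which is compact by Tychonoff.\<close>

lemma compact_unit_sphere: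
  assumes fX: "finite X"
  shows "compact {u \<in> vecs X. op_inner X u u = 1 \<and> (\<forall>j\<in>J. op_inner X (\<phi> j) u = 0)}" (is "compact ?K")
proof -
  define B where "B = PiE UNIV (\<lambda>x. if x \<in> X then cball (0::complex) 1 else {0})"
  have "compactin (product_topology (\<lambda>_. euclidean) UNIV) B"
    unfolding B_def by (auto simp: compactin_PiE)
  then have cB: "compact B" by (simp add: euclidean_product_topology)
  have coord: "continuous_on UNIV (\<lambda>u::'a \<Rightarrow> complex. u x)" for x
    by (rule continuous_on_product_coordinates)
  have ci: "continuous_on UNIV (\<lambda>u. op_inner X (w u) u)" if "\<And>x. continuous_on UNIV (\<lambda>u. w u x)" for w
    unfolding op_inner_def by (intro continuous_intros coord that)
  have "closed {u. op_inner X u u = 1}"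
    by (intro closed_Collect_eq ci coord continuous_intros)
  moreover have "closed {u. op_inner X (\<phi> j) u = 0}" for j
    by (intro closed_Collect_eq ci coord continuous_intros)
  moreover have "?K = B \<inter> ({u. op_inner X u u = 1} \<inter> (\<Inter>j\<in>J. {u. op_inner X (\<phi> j) u = 0}))"
  proof -
    have "u \<in> B" if "u \<in> vecs X" "op_inner X u u = 1" for u
    proof -
      have "cmod (u x) \<le> 1" if "x \<in> X" for x
      proof -
        have "(cmod (u x))\<^sup>2 \<le> (\<Sum>x\<in>X. (cmod (u x))\<^sup>2)"
          using fX that by (intro member_le_sum) auto
        also have "\<dots> = 1" using \<open>op_inner X u u = 1\<close> unfolding op_inner_self
          by (simp only: of_real_eq_1_iff)
        finally show ?thesis by (simp add: power2_eq_square[symmetric] abs_square_le_1)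
      qed
      then show ?thesis using that by (auto simp: B_def vecs_def PiE_def Pi_def)
    qed
    moreover have "u \<in> vecs X" if "u \<in> B" for u
      unfolding vecs_def
    proof clarify
      fix x assume "x \<notin> X"
      then show "u x = 0" using that unfolding B_def by (auto dest: PiE_mem[of u UNIV _ x])
    qed
    ultimately show ?thesis by auto
  qed
  ultimately show ?thesis
    using cB by (auto intro!: compact_Int_closed closed_Int closed_INT)
qed

text \<open>A maximizer of the Rayleigh quotient on the orthogonal complement of the \<open>\<phi> j\<close>.\<close>
lemma ex_orthogonal_eigenvector:
  assumes fX: "finite X" and M: "M \<in> ops X" "self_adjoint M" and J: "J \<subset> X"
    and on: "\<And>i j. i \<in> J \<Longrightarrow> j \<in> J \<Longrightarrow> op_inner X (\<phi> i) (\<phi> j) = (if i = j then 1 else 0)"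
    and eig: "\<And>j x. j \<in> J \<Longrightarrow> x \<in> X \<Longrightarrow> op_apply X M (\<phi> j) x = of_real (\<mu> j) * \<phi> j x"
  obtains u m where "op_inner X u u = 1" "\<And>j. j \<in> J \<Longrightarrow> op_inner X (\<phi> j) u = 0"
    "\<And>x. x \<in> X \<Longrightarrow> op_apply X M u x = of_real m * u x"
proof -
  define K where "K = {u \<in> vecs X. op_inner X u u = 1 \<and> (\<forall>j\<in>J. op_inner X (\<phi> j) u = 0)}"
  define q where "q = (\<lambda>u. Re (op_inner X u (op_apply X M u)))"
  have fJ: "finite J" using J fX finite_subset by blast
  have scale: "\<exists>c>0. (\<lambda>x. of_real c * w x) \<in> K \<and> c\<^sup>2 * Re (op_inner X w w) = 1"
    if "w \<in> vecs X" "\<And>j. j \<in> J \<Longrightarrow> op_inner X (\<phi> j) w = 0" "Re (op_inner X w w) > 0" for w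
  proof -
    define c where "c = 1 / sqrt (Re (op_inner X w w))"
    have c: "c > 0" "c\<^sup>2 * Re (op_inner X w w) = 1"
      using that(3) by (simp_all add: c_def power_divide)
    have "op_inner X (\<lambda>x. of_real c * w x) (\<lambda>x. of_real c * w x) = of_real (c\<^sup>2 * Re (op_inner X w w))"
      by (simp add: op_inner_self norm_mult power_mult_distrib sum_distrib_left)
    then have "(\<lambda>x. of_real c * w x) \<in> K" using that c
      by (simp add: K_def op_inner_scale_right vecs_def)
    then show ?thesis using c by blast
  qed
  \<comment> \<open>As \<open>card J < card X\<close>, double counting yields a basis vector whose
    projection onto the span of the \<open>\<phi> j\<close> is shorter than 1. Its residual,
    normalized, lies in \<open>K\<close>.\<close>
  have "\<exists>x\<in>X. (\<Sum>j\<in>J. (cmod (\<phi> j x))\<^sup>2) < 1"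
  proof (rule ccontr)
    assume "\<not> ?thesis"
    then have "(\<Sum>x\<in>X. 1) \<le> (\<Sum>x\<in>X. \<Sum>j\<in>J. (cmod (\<phi> j x))\<^sup>2)"
      by (intro sum_mono) auto
    also have "\<dots> = card J" using on by (intro sum_cmod_orthonormal) auto
    finally show False using psubset_card_mono[OF fX J] by simp
  qed
  then obtain x where x: "x \<in> X" "(\<Sum>j\<in>J. (cmod (\<phi> j x))\<^sup>2) < 1" by blast
  \<comment> \<open>The residual is cut off outside \<open>X\<close> because the
    \<open>\<phi> j\<close> need not be in \<open>vecs X\<close>.\<close>
  define w where "w = (\<lambda>y. if y \<in> X then (if y = x then 1 else 0) - (\<Sum>j\<in>J. cnj (\<phi> j x) * \<phi> j y) else 0)"
  have w: "w \<in> vecs X" by (simp add: w_def vecs_def)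
  have "op_inner X (\<phi> j) w = 0" if "j \<in> J" for j
    using residual_norm(1)[OF fX x(1) fJ on that]
    by (subst op_inner_cong[where u' = "\<phi> j" and w' = "\<lambda>y. (if y = x then 1 else 0) - (\<Sum>j\<in>J. cnj (\<phi> j x) * \<phi> j y)"])
       (auto simp: w_def)
  moreover have "op_inner X w w = of_real (1 - (\<Sum>j\<in>J. (cmod (\<phi> j x))\<^sup>2))"
    by (subst residual_norm(2)[OF fX x(1) fJ on, symmetric]) (auto simp: w_def intro!: op_inner_cong)
  then have "Re (op_inner X w w) > 0" using x by simp
  ultimately have "K \<noteq> {}" using scale[OF w] by blast
  moreover have "compact K" unfolding K_def by (rule compact_unit_sphere[OF fX])
  moreover have "continuous_on K q"
  proof -
    have coord: "continuous_on UNIV (\<lambda>u::'a \<Rightarrow> complex. u x)" for x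
      by (rule continuous_on_product_coordinates)
    have "continuous_on UNIV q" unfolding q_def op_inner_def op_apply_def
      by (intro continuous_intros coord)
    then show ?thesis using continuous_on_subset by blast
  qed
  ultimately obtain u where u: "u \<in> K" and max: "\<And>w. w \<in> K \<Longrightarrow> q w \<le> q u"
    using continuous_attains_sup by metis
  define m where "m = q u"
  \<comment> \<open>By homogeneity, the maximum over unit vectors bounds the form on the whole
    orthogonal complement.\<close>
  have le: "q w \<le> m * Re (op_inner X w w)"
    if w: "w \<in> vecs X" "\<And>j. j \<in> J \<Longrightarrow> op_inner X (\<phi> j) w = 0" for w
  proof (cases "Re (op_inner X w w) > 0")
    case True
    then obtain c where c: "c > 0" "(\<lambda>x. of_real c * w x) \<in> K" "c\<^sup>2 * Re (op_inner X w w) = 1"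
      using scale[OF w] by blast
    have "q (\<lambda>x. of_real c * w x) = c\<^sup>2 * q w"
    proof -
      have "op_inner X (\<lambda>x. of_real c * w x) v = of_real c * op_inner X w v" for v
        by (simp add: op_inner_def sum_distrib_left mult_ac)
      then show ?thesis by (simp add: q_def op_apply_scale op_inner_scale_right power2_eq_square)
    qed
    then have "c\<^sup>2 * q w \<le> m * (c\<^sup>2 * Re (op_inner X w w))" using max[OF c(2)] c(3) by (simp add: m_def)
    then have "c\<^sup>2 * q w \<le> c\<^sup>2 * (m * Re (op_inner X w w))" by (simp add: mult_ac)
    then show ?thesis using c(1) by simp
  next
    case False
    then have "Re (op_inner X w w) = 0"
      using sum_nonneg[of X "\<lambda>x. (cmod (w x))\<^sup>2"] by (simp add: op_inner_self)
    then have 0: "\<forall>x\<in>X. w x = 0" using fX op_inner_self_eq_0 by blast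
    then have "q w = 0" unfolding q_def op_inner_def by simp
    with \<open>Re (op_inner X w w) = 0\<close> show ?thesis by simp
  qed
  \<comment> \<open>The failure of \<open>u\<close> to be an eigenvector for \<open>m\<close>. It is
    orthogonal to the \<open>\<phi> j\<close>, as \<open>M\<close> maps their complement into
    itself, so \<open>u\<close> may be perturbed in the direction \<open>v\<close>.\<close>
  define v where "v = (\<lambda>x. op_apply X M u x - of_real m * u x)"
  have uv: "u \<in> vecs X" and uu: "op_inner X u u = 1" and uo: "\<And>j. j \<in> J \<Longrightarrow> op_inner X (\<phi> j) u = 0"
    using u by (auto simp: K_def)
  have vv: "v \<in> vecs X" using uv op_apply_vecs[OF M(1), of u] by (simp add: v_def vecs_def)
  have vo: "op_inner X (\<phi> j) v = 0" if "j \<in> J" for j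
  proof -
    have "op_inner X (\<phi> j) (op_apply X M u) = op_inner X (op_apply X M (\<phi> j)) u"
      by (rule op_inner_apply_self_adjoint[OF M(2)])
    also have "\<dots> = op_inner X (\<lambda>x. of_real (\<mu> j) * \<phi> j x) u"
      using eig[OF that] by (intro op_inner_cong) auto
    also have "\<dots> = of_real (\<mu> j) * op_inner X (\<phi> j) u"
      by (simp add: op_inner_def sum_distrib_left mult_ac)
    finally show ?thesis using uo[OF that] by (simp add: v_def op_inner_diff_right op_inner_scale_right)
  qed
  \<comment> \<open>Comparing \<open>u + s v\<close> with the bound \<open>le\<close>, the terms of
    first order in \<open>s\<close> leave exactly \<open>2 * s\<close> times the squared norm of
    \<open>v\<close>.\<close>
  have "Re (op_inner X v v) = 0"
  proof (rule quadratic_nonpos_imp_zero[where b = "q v - m * Re (op_inner X v v)"])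
    show "0 \<le> Re (op_inner X v v)" by (simp add: op_inner_self sum_nonneg)
    fix s :: real
    define w where "w = (\<lambda>x. u x + of_real s * v x)"
    have wl: "op_inner X w z = op_inner X u z + of_real s * op_inner X v z" for z
      by (simp add: w_def op_inner_def sum_distrib_left algebra_simps sum.distrib)
    have wr: "op_inner X z w = op_inner X z u + of_real s * op_inner X z v" for z
      by (simp add: w_def op_inner_add_right op_inner_scale_right)
    have "q w \<le> m * Re (op_inner X w w)"
    proof (rule le)
      show "w \<in> vecs X" using uv vv by (simp add: w_def vecs_def)
      show "op_inner X (\<phi> j) w = 0" if "j \<in> J" for j using uo vo that by (simp add: wr)
    qed
    moreover have "q w = q u + 2 * s * Re (op_inner X v (op_apply X M u)) + s\<^sup>2 * q v"
    proof -
      have "op_inner X u (op_apply X M v) = cnj (op_inner X v (op_apply X M u))"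
        by (simp add: op_inner_cnj op_inner_apply_self_adjoint[OF M(2)])
      then show ?thesis unfolding q_def wl
        unfolding w_def op_apply_add op_apply_scale op_inner_add_right op_inner_scale_right
        by (simp add: power2_eq_square algebra_simps)
    qed
    moreover have "Re (op_inner X w w) = 1 + 2 * s * Re (op_inner X v u) + s\<^sup>2 * Re (op_inner X v v)"
    proof -
      have "op_inner X u v = cnj (op_inner X v u)" by (simp add: op_inner_cnj)
      then show ?thesis unfolding wl wr by (simp add: uu power2_eq_square algebra_simps)
    qed
    moreover have "Re (op_inner X v (op_apply X M u)) = m * Re (op_inner X v u) + Re (op_inner X v v)"
    proof -
      have "op_inner X v v = op_inner X v (op_apply X M u) - of_real m * op_inner X v u"
        unfolding op_inner_diff_right[symmetric] op_inner_scale_right[symmetric]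
        by (simp only: v_def)
      then show ?thesis by simp
    qed
    ultimately show "2 * s * Re (op_inner X v v) + s\<^sup>2 * (q v - m * Re (op_inner X v v)) \<le> 0"
      by (simp add: m_def algebra_simps)
  qed
  then have "\<forall>x\<in>X. v x = 0" using fX op_inner_self_eq_0 by blast
  then show ?thesis using that[OF uu uo, of m] by (simp add: v_def)
qed

text \<open>Indices are added one at a time, each with a unit eigenvector orthogonal to the earlier
  ones. The induction runs over subsets \<open>J\<close> of \<open>X\<close>, since only a proper
  subset leaves room for another eigenvector.\<close>

lemma ex_eigenbasis:
  assumes fX: "finite X" and M: "M \<in> ops X" "self_adjoint M"
  obtains \<phi> \<mu> where "eigenbasis X M \<phi> \<mu>"
proof -
  have "\<exists>\<phi> \<mu>. (\<forall>i\<in>J. \<forall>j\<in>J. op_inner X (\<phi> i) (\<phi> j) = (if i = j then 1 else 0)) \<and>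
    (\<forall>j\<in>J. \<forall>x\<in>X. op_apply X M (\<phi> j) x = of_real (\<mu> j) * \<phi> j x)" if "J \<subseteq> X" for J
    using finite_subset[OF that fX] that
  proof (induction J rule: finite_induct)
    case empty
    then show ?case by simp
  next
    case (insert k J)
    then obtain \<phi> \<mu> where on: "\<And>i j. i \<in> J \<Longrightarrow> j \<in> J \<Longrightarrow> op_inner X (\<phi> i) (\<phi> j) = (if i = j then 1 else 0)"
      and eig: "\<And>j x. j \<in> J \<Longrightarrow> x \<in> X \<Longrightarrow> op_apply X M (\<phi> j) x = of_real (\<mu> j) * \<phi> j x"
      by blast
    have "J \<subset> X" using insert by blast
    then obtain u m where u: "op_inner X u u = 1" "\<And>j. j \<in> J \<Longrightarrow> op_inner X (\<phi> j) u = 0"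
      "\<And>x. x \<in> X \<Longrightarrow> op_apply X M u x = of_real m * u x"
      using ex_orthogonal_eigenvector[OF fX M _ on eig] by blast
    have u': "op_inner X u (\<phi> j) = 0" if "j \<in> J" for j
      using u(2)[OF that] by (metis op_inner_cnj complex_cnj_zero)
    show ?case
      by (rule exI[of _ "\<phi>(k := u)"], rule exI[of _ "\<mu>(k := m)"])
         (use insert(2) in \<open>auto simp: on eig u u'\<close>)
  qed
  from this[of X] that show ?thesis unfolding eigenbasis_def by blast
qed

section \<open>Calculating in an eigenbasis\<close>

lemma eigenbasisD:
  assumes "eigenbasis X M \<phi> \<mu>"
  shows "\<And>i j. i \<in> X \<Longrightarrow> j \<in> X \<Longrightarrow> op_inner X (\<phi> i) (\<phi> j) = (if i = j then 1 else 0)"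
    and "\<And>j x. j \<in> X \<Longrightarrow> x \<in> X \<Longrightarrow> op_apply X M (\<phi> j) x = of_real (\<mu> j) * \<phi> j x"
  using assms unfolding eigenbasis_def by blast+

lemma eigenbasis_complete:
  assumes "finite X" "eigenbasis X M \<phi> \<mu>" "x \<in> X" "y \<in> X"
  shows "(\<Sum>j\<in>X. \<phi> j x * cnj (\<phi> j y)) = (if x = y then 1 else 0)"
  using orthonormal_complete[OF assms(1) eigenbasisD(1)[OF assms(2)] assms(3,4)] by blast

lemma eigenbasis_expand:
  assumes "finite X" "eigenbasis X M \<phi> \<mu>" "x \<in> X"
  shows "(\<Sum>j\<in>X. \<phi> j x * op_inner X (\<phi> j) u) = u x"
proof -
  have "(\<Sum>j\<in>X. \<phi> j x * op_inner X (\<phi> j) u) = (\<Sum>j\<in>X. \<Sum>y\<in>X. \<phi> j x * cnj (\<phi> j y) * u y)"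
    by (simp add: op_inner_def sum_distrib_left mult.assoc)
  also have "\<dots> = (\<Sum>y\<in>X. (\<Sum>j\<in>X. \<phi> j x * cnj (\<phi> j y)) * u y)"
    by (subst sum.swap) (simp add: sum_distrib_right)
  also have "\<dots> = (\<Sum>y\<in>X. (if x = y then 1 else 0) * u y)"
    using eigenbasis_complete[OF assms] by (intro sum.cong) auto
  also have "\<dots> = u x" using assms by (simp add: if_distrib if_distribR cong: if_cong)
  finally show ?thesis .
qed

lemma parseval:
  assumes "finite X" "eigenbasis X M \<phi> \<mu>"
  shows "(\<Sum>j\<in>X. op_inner X u (\<phi> j) * op_inner X (\<phi> j) w) = op_inner X u w"
proof -
  have "op_inner X u w = op_inner X u (\<lambda>x. \<Sum>j\<in>X. op_inner X (\<phi> j) w * \<phi> j x)"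
    using eigenbasis_expand[OF assms, of _ w] by (intro op_inner_cong) (auto simp: mult.commute)
  also have "\<dots> = (\<Sum>j\<in>X. op_inner X u (\<phi> j) * op_inner X (\<phi> j) w)"
    unfolding op_inner_sum_right op_inner_scale_right by (simp add: mult.commute)
  finally show ?thesis by simp
qed

lemma parseval_norm:
  assumes "finite X" "eigenbasis X M \<phi> \<mu>"
  shows "(\<Sum>j\<in>X. (cmod (op_inner X (\<phi> j) u))\<^sup>2) = (\<Sum>x\<in>X. (cmod (u x))\<^sup>2)"
proof -
  have "complex_of_real (\<Sum>j\<in>X. (cmod (op_inner X (\<phi> j) u))\<^sup>2)
      = (\<Sum>j\<in>X. op_inner X u (\<phi> j) * op_inner X (\<phi> j) u)"
    using op_inner_cnj[of X _ u]
    by (simp add: complex_norm_square mult.commute del: of_real_power)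
  also have "\<dots> = of_real (\<Sum>x\<in>X. (cmod (u x))\<^sup>2)"
    using parseval[OF assms] by (simp add: op_inner_self)
  finally show ?thesis by (simp only: of_real_eq_iff)
qed

text \<open>The spectral decomposition, obtained by inserting the completeness relation to the right
  of \<open>M\<close>.\<close>

lemma eigenbasis_entry:
  assumes "finite X" "eigenbasis X M \<phi> \<mu>" "x \<in> X" "y \<in> X"
  shows "M x y = (\<Sum>j\<in>X. of_real (\<mu> j) * \<phi> j x * cnj (\<phi> j y))"
proof -
  have "M x y = (\<Sum>z\<in>X. M x z * (if z = y then 1 else 0))"
    using assms by (simp add: if_distrib cong: if_cong)
  also have "\<dots> = (\<Sum>z\<in>X. M x z * (\<Sum>j\<in>X. \<phi> j z * cnj (\<phi> j y)))"
    using eigenbasis_complete[OF assms(1,2) _ assms(4)] by (intro sum.cong) auto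
  also have "\<dots> = (\<Sum>j\<in>X. op_apply X M (\<phi> j) x * cnj (\<phi> j y))"
    unfolding op_apply_def sum_distrib_left sum_distrib_right
    by (subst sum.swap) (simp add: mult.assoc)
  finally show ?thesis using eigenbasisD(2)[OF assms(2)] assms(3) by simp
qed

lemma eigenbasis_inner_apply:
  assumes "finite X" "eigenbasis X M \<phi> \<mu>"
  shows "op_inner X u (op_apply X M w)
    = (\<Sum>j\<in>X. of_real (\<mu> j) * op_inner X u (\<phi> j) * op_inner X (\<phi> j) w)"
proof -
  have "op_apply X M w x = (\<Sum>j\<in>X. (of_real (\<mu> j) * op_inner X (\<phi> j) w) * \<phi> j x)" if "x \<in> X" for x
  proof -
    have "op_apply X M w x = (\<Sum>y\<in>X. \<Sum>j\<in>X. of_real (\<mu> j) * \<phi> j x * cnj (\<phi> j y) * w y)"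
      by (simp add: op_apply_def eigenbasis_entry[OF assms that] sum_distrib_right)
    also have "\<dots> = (\<Sum>j\<in>X. (of_real (\<mu> j) * op_inner X (\<phi> j) w) * \<phi> j x)"
      unfolding op_inner_def sum_distrib_left sum_distrib_right
      by (subst sum.swap) (simp add: mult_ac)
    finally show ?thesis .
  qed
  then have "op_inner X u (op_apply X M w)
     = op_inner X u (\<lambda>x. \<Sum>j\<in>X. (of_real (\<mu> j) * op_inner X (\<phi> j) w) * \<phi> j x)"
    by (intro op_inner_cong) auto
  then show ?thesis unfolding op_inner_sum_right op_inner_scale_right by (simp add: mult_ac)
qed

lemma eigenbasis_trace:
  assumes "finite X" "eigenbasis X M \<phi> \<mu>"
  shows "op_trace X M = of_real (\<Sum>j\<in>X. \<mu> j)"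
proof -
  have "op_trace X M = (\<Sum>x\<in>X. \<Sum>j\<in>X. of_real (\<mu> j) * \<phi> j x * cnj (\<phi> j x))"
    unfolding op_trace_def by (intro sum.cong refl eigenbasis_entry assms)
  also have "\<dots> = (\<Sum>j\<in>X. of_real (\<mu> j) * op_inner X (\<phi> j) (\<phi> j))"
    unfolding op_inner_def sum_distrib_left by (subst sum.swap) (simp add: mult_ac)
  also have "\<dots> = (\<Sum>j\<in>X. of_real (\<mu> j))" by (simp add: eigenbasisD(1)[OF assms(2)])
  finally show ?thesis by simp
qed

lemma eigenbasis_mult:
  assumes "eigenbasis X M \<phi> \<mu>" "eigenbasis X N \<phi> \<nu>"
  shows "eigenbasis X (op_mult X M N) \<phi> (\<lambda>j. \<mu> j * \<nu> j)"
proof -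
  have "op_apply X (op_mult X M N) (\<phi> j) x = of_real (\<mu> j * \<nu> j) * \<phi> j x"
    if "j \<in> X" "x \<in> X" for j x
  proof -
    have "op_apply X (op_mult X M N) (\<phi> j) x = op_apply X M (op_apply X N (\<phi> j)) x"
      unfolding op_apply_def op_mult_def sum_distrib_left sum_distrib_right
      by (subst sum.swap) (simp add: mult.assoc)
    also have "\<dots> = op_apply X M (\<lambda>x. of_real (\<nu> j) * \<phi> j x) x"
      using eigenbasisD(2)[OF assms(2) that(1)] unfolding op_apply_def[of X M] by simp
    also have "\<dots> = of_real (\<mu> j * \<nu> j) * \<phi> j x"
      using eigenbasisD(2)[OF assms(1) that] by (simp add: op_apply_scale)
    finally show ?thesis .
  qed
  then show ?thesis using assms unfolding eigenbasis_def by blast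
qed

section \<open>Functional calculus\<close>

text \<open>The operator \<open>L\<close> built from one eigenbasis satisfies the definite
  description behind \<open>op_fun\<close>, and any other solution has the same eigenvectors and
  eigenvalues, hence the same entries. Thus every eigenbasis of \<open>M\<close> can be used to
  evaluate \<open>op_fun\<close>.\<close>

lemma eigenbasis_op_fun:
  assumes fX: "finite X" and M: "M \<in> ops X" and eb: "eigenbasis X M \<phi> \<mu>"
  shows "eigenbasis X (op_fun X f M) \<phi> (\<lambda>j. f (\<mu> j))"
proof -
  define L where "L = (\<lambda>x y. if x \<in> X \<and> y \<in> X
    then \<Sum>j\<in>X. of_real (f (\<mu> j)) * \<phi> j x * cnj (\<phi> j y) else 0)"
  have Lapp: "op_apply X L u x = (\<Sum>j\<in>X. of_real (f (\<mu> j)) * \<phi> j x * op_inner X (\<phi> j) u)"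
    if "x \<in> X" for x u
  proof -
    have "op_apply X L u x = (\<Sum>y\<in>X. \<Sum>j\<in>X. of_real (f (\<mu> j)) * \<phi> j x * cnj (\<phi> j y) * u y)"
      using that by (simp add: op_apply_def L_def sum_distrib_right)
    also have "\<dots> = (\<Sum>j\<in>X. of_real (f (\<mu> j)) * \<phi> j x * op_inner X (\<phi> j) u)"
      unfolding op_inner_def sum_distrib_left by (subst sum.swap) (simp add: mult_ac)
    finally show ?thesis .
  qed
  have Leb: "eigenbasis X L \<phi> (\<lambda>j. f (\<mu> j))"
  proof -
    have "op_apply X L (\<phi> j) x = of_real (f (\<mu> j)) * \<phi> j x" if "j \<in> X" "x \<in> X" for j x
      using that fX by (simp add: Lapp eigenbasisD(1)[OF eb] if_distrib if_distribR cong: if_cong)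
    then show ?thesis using eb by (simp add: eigenbasis_def)
  qed
  have "op_fun X f M = L"
    unfolding op_fun_def
  proof (rule the_equality, intro conjI allI ballI impI)
    show Lops: "L \<in> ops X" by (auto simp: L_def ops_def)
    fix m :: real and u assume u: "u \<in> vecs X" "op_apply X M u = (\<lambda>x. of_real m * u x)"
    show "op_apply X L u = (\<lambda>x. of_real (f m) * u x)"
    proof
      fix x
      show "op_apply X L u x = of_real (f m) * u x"
      proof (cases "x \<in> X")
        case False
        then show ?thesis using u op_apply_vecs[OF Lops, of u] by (simp add: vecs_def)
      next
        case True
        \<comment> \<open>An eigenvector for \<open>m\<close> has zero coefficient at every
          \<open>j\<close> with \<open>\<mu> j \<noteq> m\<close>; at the others the two factors
          agree.\<close>
        have "of_real (f (\<mu> j)) * op_inner X (\<phi> j) u = of_real (f m) * op_inner X (\<phi> j) u"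
          if j: "j \<in> X" for j
        proof -
          have "of_real m * op_inner X (\<phi> j) u = op_inner X (\<phi> j) (op_apply X M u)"
            by (simp add: u op_inner_scale_right)
          also have "\<dots> = (\<Sum>i\<in>X. (if j = i then 1 else 0) * (of_real (\<mu> i) * op_inner X (\<phi> i) u))"
            unfolding eigenbasis_inner_apply[OF fX eb]
            by (intro sum.cong) (auto simp: eigenbasisD(1)[OF eb j])
          also have "\<dots> = of_real (\<mu> j) * op_inner X (\<phi> j) u"
            using fX j by (simp add: if_distrib if_distribR cong: if_cong)
          finally show ?thesis by auto
        qed
        then have "op_apply X L u x = (\<Sum>j\<in>X. of_real (f m) * (\<phi> j x * op_inner X (\<phi> j) u))"
          unfolding Lapp[OF True] by (intro sum.cong) (auto simp: mult_ac)
        then show ?thesis using eigenbasis_expand[OF fX eb True] by (simp flip: sum_distrib_left)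
      qed
    qed
  next
    fix L' assume L': "L' \<in> ops X \<and>
      (\<forall>m::real. \<forall>u\<in>vecs X. op_apply X M u = (\<lambda>x. of_real m * u x) \<longrightarrow>
         op_apply X L' u = (\<lambda>x. of_real (f m) * u x))"
    have "op_apply X L' (\<phi> j) x = of_real (f (\<mu> j)) * \<phi> j x" if j: "j \<in> X" "x \<in> X" for j x
    proof -
      \<comment> \<open>The description tests vectors in \<open>vecs X\<close> only, so
        \<open>\<phi> j\<close> is cut off outside \<open>X\<close>.\<close>
      define u where "u = (\<lambda>x. if x \<in> X then \<phi> j x else 0)"
      have uv: "u \<in> vecs X" by (simp add: u_def vecs_def)
      have cut: "op_apply X N u = op_apply X N (\<phi> j)" for N
        by (auto simp: op_apply_def u_def)
      have "op_apply X M u = (\<lambda>x. of_real (\<mu> j) * u x)"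
      proof
        fix x
        show "op_apply X M u x = of_real (\<mu> j) * u x"
          using op_apply_vecs[OF M, of u] eigenbasisD(2)[OF eb j(1)]
          by (cases "x \<in> X") (auto simp: vecs_def cut, auto simp: u_def)
      qed
      then have "op_apply X L' u = (\<lambda>x. of_real (f (\<mu> j)) * u x)" using L' uv by blast
      then show ?thesis using j by (metis cut u_def)
    qed
    then have "eigenbasis X L' \<phi> (\<lambda>j. f (\<mu> j))" using eb by (simp add: eigenbasis_def)
    then have "L' x y = L x y" if "x \<in> X" "y \<in> X" for x y
      using eigenbasis_entry[OF fX _ that, of _ \<phi> "\<lambda>j. f (\<mu> j)"] that by (simp add: L_def)
    then show "L' = L" using L' by (auto simp: L_def ops_def fun_eq_iff)
  qed
  then show ?thesis using Leb by simp
qed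

lemma trace_mult_log:
  assumes "finite X" "M \<in> ops X" "eigenbasis X M \<phi> \<mu>"
  shows "Re (op_trace X (op_mult X M (op_log X M))) = (\<Sum>j\<in>X. \<mu> j * ln (\<mu> j))"
  using eigenbasis_trace[OF assms(1) eigenbasis_mult[OF assms(3) eigenbasis_op_fun[OF assms]]]
  by simp

section \<open>Change of index set and positivity\<close>

lemma op_inner_reindex:
  assumes "bij_betw g Y X"
  shows "op_inner Y (\<lambda>y. u (g y)) (\<lambda>y. w (g y)) = op_inner X u w"
  unfolding op_inner_def by (rule sum.reindex_bij_betw[OF assms])

lemma op_apply_reindex:
  assumes "bij_betw g Y X"
  shows "op_apply Y (\<lambda>y z. M (g y) (g z)) (\<lambda>y. u (g y)) = (\<lambda>y. op_apply X M u (g y))"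
  unfolding op_apply_def by (rule ext) (rule sum.reindex_bij_betw[OF assms])

text \<open>Configurations of a union and tuples of configurations index the same space; this moves
  eigenbases from one description to the other.\<close>

lemma eigenbasis_reindex:
  assumes eb: "eigenbasis X M \<phi> \<mu>" and g: "bij_betw g Y X"
  shows "eigenbasis Y (\<lambda>y z. M (g y) (g z)) (\<lambda>j y. \<phi> (g j) (g y)) (\<lambda>j. \<mu> (g j))"
proof -
  have gX: "g y \<in> X" if "y \<in> Y" for y using g that bij_betwE by blast
  have inj: "g y = g z \<longleftrightarrow> y = z" if "y \<in> Y" "z \<in> Y" for y z
    using g that by (metis bij_betw_def inj_on_eq_iff)
  show ?thesis
    unfolding eigenbasis_def op_inner_reindex[OF g] op_apply_reindex[OF g]
    using gX inj eigenbasisD[OF eb] by simp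
qed

lemma eigenbasis_cong:
  assumes "eigenbasis X M \<phi> \<mu>" "\<And>x y. x \<in> X \<Longrightarrow> y \<in> X \<Longrightarrow> N x y = M x y"
  shows "eigenbasis X N \<phi> \<mu>"
proof -
  have "op_apply X N u x = op_apply X M u x" if "x \<in> X" for u x
    using assms(2) that by (simp add: op_apply_def)
  then show ?thesis using assms(1) by (simp add: eigenbasis_def)
qed

text \<open>An eigenvalue is the value of the quadratic form at its unit eigenvector, here cut off
  outside \<open>X\<close> to lie in \<open>vecs X\<close>.\<close>

lemma pos_eigenvalues:
  assumes fX: "finite X" and pd: "positive_definite X M" and eb: "eigenbasis X M \<phi> \<mu>" and j: "j \<in> X"
  shows "\<mu> j > 0"
proof -
  define u where "u = (\<lambda>x. if x \<in> X then \<phi> j x else 0)"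
  have i: "op_inner X u w = op_inner X (\<phi> j) w" for w by (simp add: op_inner_def u_def)
  have a: "op_apply X M u = op_apply X M (\<phi> j)" by (auto simp: op_apply_def u_def)
  have "op_inner X u (op_apply X M u) = op_inner X (\<phi> j) (\<lambda>x. of_real (\<mu> j) * \<phi> j x)"
    unfolding i a using eigenbasisD(2)[OF eb j] by (intro op_inner_cong) auto
  also have "\<dots> = of_real (\<mu> j)" by (simp add: op_inner_scale_right eigenbasisD(1)[OF eb j j])
  finally have "Re (op_inner X u (op_apply X M u)) = \<mu> j" by simp
  moreover have "u \<in> vecs X" by (simp add: u_def vecs_def)
  moreover have "u \<noteq> (\<lambda>x. 0)"
  proof
    assume "u = (\<lambda>x. 0)"
    then have "op_inner X (\<phi> j) (\<phi> j) = 0" using i[of "\<phi> j"] by (simp add: op_inner_def)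
    then show False by (simp add: eigenbasisD(1)[OF eb j j])
  qed
  ultimately show ?thesis using pd unfolding positive_definite_def by metis
qed

lemma positive_definite_eigenbasis:
  assumes "finite X" "M \<in> ops X" "positive_definite X M"
  obtains \<phi> \<mu> where "eigenbasis X M \<phi> \<mu>" "\<And>j. j \<in> X \<Longrightarrow> \<mu> j > 0"
  using assms ex_eigenbasis pos_eigenvalues unfolding positive_definite_def by metis

section \<open>Monotonicity of the relative entropy\<close>

text \<open>
  \<open>2 Re Tr(K\<^sup>* R) - Tr(K\<^sup>* S K) - t Tr(K R K\<^sup>*)\<close>, maximal at the solution of \<open>S K + t K R = R\<close>.
\<close>
definition rel_form ::
  "'x set \<Rightarrow> real \<Rightarrow> ('x \<Rightarrow> 'x \<Rightarrow> complex) \<Rightarrow> ('x \<Rightarrow> 'x \<Rightarrow> complex) \<Rightarrow> ('x \<Rightarrow> 'x \<Rightarrow> complex) \<Rightarrow> real"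
  where "rel_form X t R S K =
     2 * Re (\<Sum>x\<in>X. \<Sum>y\<in>X. cnj (K x y) * R x y)
     - Re (\<Sum>z\<in>X. \<Sum>x\<in>X. \<Sum>y\<in>X. cnj (K x z) * S x y * K y z)
     - t * Re (\<Sum>x\<in>X. \<Sum>y\<in>X. \<Sum>z\<in>X. cnj (K x z) * K x y * R y z)"

text \<open>In the coefficients \<open>\<kappa> K j k\<close> of \<open>K\<close> between the two
  eigenbases all three terms become diagonal, so the form splits into independent quadratics, one
  for each pair \<open>(j, k)\<close>.\<close>

lemma rel_form_eigenbasis:
  assumes fX: "finite X" and R: "eigenbasis X R \<phi> p" and S: "eigenbasis X S \<psi> q"
  defines "\<kappa> \<equiv> \<lambda>K j k. op_inner X (\<psi> k) (op_apply X K (\<phi> j))"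
    and "w \<equiv> \<lambda>j k. op_inner X (\<psi> k) (\<phi> j)"
  shows "rel_form X t R S K = (\<Sum>j\<in>X. \<Sum>k\<in>X.
     2 * p j * Re (cnj (\<kappa> K j k) * w j k) - (q k + t * p j) * (cmod (\<kappa> K j k))\<^sup>2)"
proof -
  have "(\<Sum>x\<in>X. \<Sum>y\<in>X. cnj (K x y) * R x y)
      = (\<Sum>x\<in>X. \<Sum>y\<in>X. \<Sum>j\<in>X. of_real (p j) * (cnj (K x y * \<phi> j y) * \<phi> j x))"
    by (intro sum.cong refl) (simp add: eigenbasis_entry[OF fX R] sum_distrib_left mult_ac)
  also have "\<dots> = (\<Sum>x\<in>X. \<Sum>j\<in>X. \<Sum>y\<in>X. of_real (p j) * (cnj (K x y * \<phi> j y) * \<phi> j x))"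
    by (rule sum.cong[OF refl]) (rule sum.swap)
  also have "\<dots> = (\<Sum>j\<in>X. \<Sum>x\<in>X. \<Sum>y\<in>X. of_real (p j) * (cnj (K x y * \<phi> j y) * \<phi> j x))"
    by (rule sum.swap)
  also have "\<dots> = (\<Sum>j\<in>X. of_real (p j) * op_inner X (op_apply X K (\<phi> j)) (\<phi> j))"
    by (simp add: op_inner_def op_apply_def sum_distrib_left sum_distrib_right)
  also have "\<dots> = (\<Sum>j\<in>X. of_real (p j) * (\<Sum>k\<in>X. cnj (\<kappa> K j k) * w j k))"
    unfolding \<kappa>_def w_def op_inner_cnj by (simp add: parseval[OF fX S])
  finally have 1: "2 * Re (\<Sum>x\<in>X. \<Sum>y\<in>X. cnj (K x y) * R x y)
     = (\<Sum>j\<in>X. \<Sum>k\<in>X. 2 * p j * Re (cnj (\<kappa> K j k) * w j k))"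
    by (simp add: sum_distrib_left mult_ac)

  \<comment> \<open>Parseval over the \<open>\<phi> j\<close>, applied to \<open>K\<close> paired on
    the left with \<open>\<psi> k\<close>; it trades the coordinate \<open>z\<close> for the index
    \<open>j\<close>.\<close>
  have \<kappa>z: "(\<Sum>z\<in>X. (cmod (op_inner X (\<psi> k) (\<lambda>x. K x z)))\<^sup>2) = (\<Sum>j\<in>X. (cmod (\<kappa> K j k))\<^sup>2)" for k
  proof -
    define h where "h = (\<lambda>z. cnj (op_inner X (\<psi> k) (\<lambda>x. K x z)))"
    have "\<kappa> K j k = cnj (op_inner X (\<phi> j) h)" for j
    proof -
      have "\<kappa> K j k = (\<Sum>z\<in>X. \<Sum>x\<in>X. cnj (\<psi> k x) * (K x z * \<phi> j z))"
        unfolding \<kappa>_def op_inner_def op_apply_def sum_distrib_left by (rule sum.swap)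
      also have "\<dots> = op_inner X h (\<phi> j)"
        by (simp add: h_def op_inner_def sum_distrib_left sum_distrib_right mult.assoc)
      finally show ?thesis by (simp add: op_inner_cnj)
    qed
    then have "(\<Sum>j\<in>X. (cmod (\<kappa> K j k))\<^sup>2) = (\<Sum>j\<in>X. (cmod (op_inner X (\<phi> j) h))\<^sup>2)" by simp
    also have "\<dots> = (\<Sum>z\<in>X. (cmod (h z))\<^sup>2)" by (rule parseval_norm[OF fX R])
    finally show ?thesis by (simp add: h_def)
  qed
  have "(\<Sum>x\<in>X. \<Sum>y\<in>X. cnj (K x z) * S x y * K y z)
      = of_real (\<Sum>k\<in>X. q k * (cmod (op_inner X (\<psi> k) (\<lambda>x. K x z)))\<^sup>2)" for z
  proof -
    have "(\<Sum>x\<in>X. \<Sum>y\<in>X. cnj (K x z) * S x y * K y z)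
       = op_inner X (\<lambda>x. K x z) (op_apply X S (\<lambda>x. K x z))"
      by (simp add: op_inner_def op_apply_def sum_distrib_left mult.assoc)
    also have "\<dots> = (\<Sum>k\<in>X. of_real (q k) * (cnj (op_inner X (\<psi> k) (\<lambda>x. K x z))
        * op_inner X (\<psi> k) (\<lambda>x. K x z)))"
      unfolding eigenbasis_inner_apply[OF fX S] op_inner_cnj by (simp add: mult.assoc)
    also have "\<dots> = of_real (\<Sum>k\<in>X. q k * (cmod (op_inner X (\<psi> k) (\<lambda>x. K x z)))\<^sup>2)"
      by (simp add: complex_norm_square mult.commute del: of_real_power)
    finally show ?thesis .
  qed
  then have "Re (\<Sum>z\<in>X. \<Sum>x\<in>X. \<Sum>y\<in>X. cnj (K x z) * S x y * K y z)
     = (\<Sum>z\<in>X. \<Sum>k\<in>X. q k * (cmod (op_inner X (\<psi> k) (\<lambda>x. K x z)))\<^sup>2)"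
    by (simp del: of_real_sum of_real_mult of_real_power)
  also have "\<dots> = (\<Sum>k\<in>X. q k * (\<Sum>j\<in>X. (cmod (\<kappa> K j k))\<^sup>2))"
    unfolding \<kappa>z[symmetric] sum_distrib_left by (rule sum.swap)
  also have "\<dots> = (\<Sum>j\<in>X. \<Sum>k\<in>X. q k * (cmod (\<kappa> K j k))\<^sup>2)"
    unfolding sum_distrib_left by (rule sum.swap)
  finally have 2: "Re (\<Sum>z\<in>X. \<Sum>x\<in>X. \<Sum>y\<in>X. cnj (K x z) * S x y * K y z)
     = (\<Sum>j\<in>X. \<Sum>k\<in>X. q k * (cmod (\<kappa> K j k))\<^sup>2)" .

  have "(\<Sum>y\<in>X. \<Sum>z\<in>X. cnj (K x z) * K x y * R y z)
      = (\<Sum>j\<in>X. of_real (p j * (cmod (op_apply X K (\<phi> j) x))\<^sup>2))" for x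
  proof -
    have "(\<Sum>y\<in>X. \<Sum>z\<in>X. cnj (K x z) * K x y * R y z)
       = (\<Sum>y\<in>X. \<Sum>z\<in>X. \<Sum>j\<in>X. of_real (p j) * ((K x y * \<phi> j y) * cnj (K x z * \<phi> j z)))"
      by (intro sum.cong refl) (simp add: eigenbasis_entry[OF fX R] sum_distrib_left mult_ac)
    also have "\<dots> = (\<Sum>y\<in>X. \<Sum>j\<in>X. \<Sum>z\<in>X. of_real (p j) * ((K x y * \<phi> j y) * cnj (K x z * \<phi> j z)))"
      by (rule sum.cong[OF refl]) (rule sum.swap)
    also have "\<dots> = (\<Sum>j\<in>X. \<Sum>y\<in>X. \<Sum>z\<in>X. of_real (p j) * ((K x y * \<phi> j y) * cnj (K x z * \<phi> j z)))"
      by (rule sum.swap)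
    also have "\<dots> = (\<Sum>j\<in>X. of_real (p j) * (op_apply X K (\<phi> j) x * cnj (op_apply X K (\<phi> j) x)))"
      unfolding op_apply_def cnj_sum sum_product by (simp add: sum_distrib_left)
    finally show ?thesis by (simp add: complex_norm_square del: of_real_power)
  qed
  then have "Re (\<Sum>x\<in>X. \<Sum>y\<in>X. \<Sum>z\<in>X. cnj (K x z) * K x y * R y z)
     = (\<Sum>x\<in>X. \<Sum>j\<in>X. p j * (cmod (op_apply X K (\<phi> j) x))\<^sup>2)"
    by (simp del: of_real_mult of_real_power)
  also have "\<dots> = (\<Sum>j\<in>X. p j * (\<Sum>x\<in>X. (cmod (op_apply X K (\<phi> j) x))\<^sup>2))"
    unfolding sum_distrib_left by (rule sum.swap)
  also have "\<dots> = (\<Sum>j\<in>X. p j * (\<Sum>k\<in>X. (cmod (\<kappa> K j k))\<^sup>2))"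
    by (simp add: \<kappa>_def parseval_norm[OF fX S])
  also have "\<dots> = (\<Sum>j\<in>X. \<Sum>k\<in>X. p j * (cmod (\<kappa> K j k))\<^sup>2)"
    by (simp add: sum_distrib_left)
  finally have 3: "Re (\<Sum>x\<in>X. \<Sum>y\<in>X. \<Sum>z\<in>X. cnj (K x z) * K x y * R y z)
     = (\<Sum>j\<in>X. \<Sum>k\<in>X. p j * (cmod (\<kappa> K j k))\<^sup>2)" .
  show ?thesis unfolding rel_form_def 1 2 3
    by (simp add: sum_subtractf sum.distrib sum_distrib_left algebra_simps)
qed

text \<open>The right side minus the left side is |c k - p w|^2 / c.\<close>

lemma complete_square:
  fixes k w :: complex and p c :: real
  assumes "c > 0"
  shows "2 * p * Re (cnj k * w) - c * (cmod k)\<^sup>2 \<le> (cmod w)\<^sup>2 * p\<^sup>2 / c"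
    and "k = of_real (p / c) * w \<Longrightarrow>
      2 * p * Re (cnj k * w) - c * (cmod k)\<^sup>2 = (cmod w)\<^sup>2 * p\<^sup>2 / c"
proof -
  have "(cmod (of_real c * k - of_real p * w))\<^sup>2
      = c * (c * (cmod k)\<^sup>2 - 2 * p * Re (cnj k * w)) + (cmod w)\<^sup>2 * p\<^sup>2"
    unfolding cmod_power2 by (simp add: power2_eq_square algebra_simps)
  then have e: "(cmod w)\<^sup>2 * p\<^sup>2 / c - (2 * p * Re (cnj k * w) - c * (cmod k)\<^sup>2)
      = (cmod (of_real c * k - of_real p * w))\<^sup>2 / c"
    using assms by (simp add: field_simps)
  then show "2 * p * Re (cnj k * w) - c * (cmod k)\<^sup>2 \<le> (cmod w)\<^sup>2 * p\<^sup>2 / c"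
    using assms by (metis diff_ge_0_iff_ge divide_nonneg_pos zero_le_power2)
  assume "k = of_real (p / c) * w"
  then have "of_real c * k - of_real p * w = 0" using assms by simp
  then show "2 * p * Re (cnj k * w) - c * (cmod k)\<^sup>2 = (cmod w)\<^sup>2 * p\<^sup>2 / c"
    using e by simp
qed

text \<open>Each quadratic is bounded by completing the square. The bounds are attained together
  because the coefficients of \<open>K\<close> between two orthonormal bases can be prescribed
  freely.\<close>

lemma rel_form_sup:
  assumes fX: "finite X" and R: "eigenbasis X R \<phi> p" and S: "eigenbasis X S \<psi> q"
    and p: "\<And>j. j \<in> X \<Longrightarrow> p j > 0" and q: "\<And>k. k \<in> X \<Longrightarrow> q k > 0" and t: "t \<ge> 0"
  defines "F \<equiv> \<Sum>j\<in>X. \<Sum>k\<in>X. (cmod (op_inner X (\<psi> k) (\<phi> j)))\<^sup>2 * (p j)\<^sup>2 / (q k + t * p j)"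
  shows "rel_form X t R S K \<le> F" and "\<exists>K. rel_form X t R S K = F"
proof -
  have c: "q k + t * p j > 0" if "j \<in> X" "k \<in> X" for j k
    using p[OF that(1)] q[OF that(2)] t by (simp add: add_pos_nonneg)
  show "rel_form X t R S K \<le> F"
    unfolding F_def rel_form_eigenbasis[OF fX R S]
    by (intro sum_mono complete_square(1) c)
  \<comment> \<open>The coefficients at which each square vanishes, and the operator that has
    them.\<close>
  define \<kappa> where "\<kappa> = (\<lambda>j k. of_real (p j / (q k + t * p j)) * op_inner X (\<psi> k) (\<phi> j))"
  define K where "K = (\<lambda>x y. \<Sum>j\<in>X. \<Sum>k\<in>X. \<kappa> j k * \<psi> k x * cnj (\<phi> j y))"
  have \<kappa>: "op_inner X (\<psi> k) (op_apply X K (\<phi> j)) = \<kappa> j k" if jk: "j \<in> X" "k \<in> X" for j k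
  proof -
    have "op_apply X K (\<phi> j) x = (\<Sum>k\<in>X. \<kappa> j k * \<psi> k x)" for x
    proof -
      have "op_apply X K (\<phi> j) x = (\<Sum>y\<in>X. \<Sum>i\<in>X. (\<Sum>k\<in>X. \<kappa> i k * \<psi> k x) * (cnj (\<phi> i y) * \<phi> j y))"
        by (simp add: op_apply_def K_def sum_distrib_right mult.assoc)
      also have "\<dots> = (\<Sum>i\<in>X. (\<Sum>k\<in>X. \<kappa> i k * \<psi> k x) * op_inner X (\<phi> i) (\<phi> j))"
        unfolding op_inner_def sum_distrib_left by (rule sum.swap)
      also have "\<dots> = (\<Sum>i\<in>X. (\<Sum>k\<in>X. \<kappa> i k * \<psi> k x) * (if i = j then 1 else 0))"
        using jk by (intro sum.cong) (auto simp: eigenbasisD(1)[OF R])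
      finally show ?thesis using fX jk by (simp add: if_distrib cong: if_cong)
    qed
    then have "op_inner X (\<psi> k) (op_apply X K (\<phi> j)) = op_inner X (\<psi> k) (\<lambda>x. \<Sum>k\<in>X. \<kappa> j k * \<psi> k x)"
      by (simp add: op_inner_def)
    also have "\<dots> = (\<Sum>l\<in>X. \<kappa> j l * (if k = l then 1 else 0))"
      unfolding op_inner_sum_right op_inner_scale_right
      using jk by (intro sum.cong) (auto simp: eigenbasisD(1)[OF S])
    finally show ?thesis using fX jk by (simp add: if_distrib cong: if_cong)
  qed
  have "rel_form X t R S K = F"
    unfolding F_def rel_form_eigenbasis[OF fX R S]
    by (intro sum.cong refl complete_square(2) c) (auto simp: \<kappa>, simp add: \<kappa>_def)
  then show "\<exists>K. rel_form X t R S K = F" by blast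
qed

section \<open>The variational form under a partial trace\<close>

definition ptrace :: "'c set \<Rightarrow> ('y \<times> 'c \<Rightarrow> 'y \<times> 'c \<Rightarrow> complex) \<Rightarrow> 'y \<Rightarrow> 'y \<Rightarrow> complex" where
  "ptrace C R = (\<lambda>y z. \<Sum>c\<in>C. R (y, c) (z, c))"

lemma sum_rotate:
  "(\<Sum>c\<in>C. \<Sum>x\<in>A. \<Sum>y\<in>B. F c x y) = (\<Sum>x\<in>A. \<Sum>y\<in>B. \<Sum>c\<in>C. F c x y)"
  by (subst sum.swap, rule sum.cong[OF refl], rule sum.swap)

lemma rel_form_tensor_one:
  fixes Y :: "'y set" and C :: "'c set" and K :: "'y \<Rightarrow> 'y \<Rightarrow> complex"
  assumes fC: "finite C"
  shows "rel_form (Y \<times> C) t R S (\<lambda>x z. if snd x = snd z then K (fst x) (fst z) else 0)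
    = rel_form Y t (ptrace C R) (ptrace C S) K"
proof -
  define L :: "'y \<times> 'c \<Rightarrow> 'y \<times> 'c \<Rightarrow> complex" where "L = (\<lambda>x z. if snd x = snd z then K (fst x) (fst z) else (0::complex))"
  \<comment> \<open>The next four facts collapse a sum over one \<open>C\<close>-component against
    an entry of \<open>L\<close> to a single term.\<close>
  have i: "(\<Sum>c\<in>C. L (y, c0) (z, c) * F c) = (if c0 \<in> C then K y z * F c0 else 0)" for y z c0 F
    using fC by (simp add: L_def if_distribR if_distrib cong: if_cong)
  have ci: "(\<Sum>c\<in>C. cnj (L (y, c0) (z, c)) * F c) = (if c0 \<in> C then cnj (K y z) * F c0 else 0)" for y z c0 F
    using fC by (simp add: L_def if_distribR if_distrib cong: if_cong)
  have ci': "(\<Sum>c\<in>C. cnj (L (y, c) (z, c0)) * F c) = (if c0 \<in> C then cnj (K y z) * F c0 else 0)" for y z c0 F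
    using fC by (simp add: L_def if_distribR if_distrib cong: if_cong)
  have i': "(\<Sum>c\<in>C. F c * L (y, c) (z, c0)) = (if c0 \<in> C then F c0 * K y z else 0)" for y z c0 F
    using fC by (simp add: L_def if_distribR if_distrib cong: if_cong)
  have p: "(\<Sum>x\<in>Y \<times> C. G x) = (\<Sum>y\<in>Y. \<Sum>c\<in>C. G (y, c))" for G :: "'y \<times> 'c \<Rightarrow> complex"
    by (simp add: sum.cartesian_product)
  have "(\<Sum>x\<in>Y \<times> C. \<Sum>y\<in>Y \<times> C. cnj (L x y) * R x y)
      = (\<Sum>x\<in>Y. \<Sum>c\<in>C. \<Sum>y\<in>Y. cnj (K x y) * R (x, c) (y, c))"
    unfolding p by (intro sum.cong refl) (simp add: ci)
  also have "\<dots> = (\<Sum>x\<in>Y. \<Sum>y\<in>Y. cnj (K x y) * ptrace C R x y)"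
    unfolding ptrace_def sum_distrib_left by (rule sum.cong[OF refl], rule sum.swap)
  finally have 1: "(\<Sum>x\<in>Y \<times> C. \<Sum>y\<in>Y \<times> C. cnj (L x y) * R x y)
      = (\<Sum>x\<in>Y. \<Sum>y\<in>Y. cnj (K x y) * ptrace C R x y)" .
  have "(\<Sum>z\<in>Y \<times> C. \<Sum>x\<in>Y \<times> C. \<Sum>y\<in>Y \<times> C. cnj (L x z) * S x y * L y z)
      = (\<Sum>z\<in>Y. \<Sum>c\<in>C. \<Sum>x\<in>Y. \<Sum>y\<in>Y. cnj (K x z) * S (x, c) (y, c) * K y z)"
  proof -
    have *: "(\<Sum>x\<in>Y. \<Sum>d\<in>C. \<Sum>y\<in>Y. \<Sum>e\<in>C. cnj (L (x, d) (z, c)) * S (x, d) (y, e) * L (y, e) (z, c))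
        = (\<Sum>x\<in>Y. \<Sum>y\<in>Y. cnj (K x z) * S (x, c) (y, c) * K y z)" if "c \<in> C" for z c
    proof (rule sum.cong[OF refl])
      fix x
      have "(\<Sum>d\<in>C. \<Sum>y\<in>Y. \<Sum>e\<in>C. cnj (L (x, d) (z, c)) * S (x, d) (y, e) * L (y, e) (z, c))
         = (\<Sum>d\<in>C. cnj (L (x, d) (z, c)) * (\<Sum>y\<in>Y. S (x, d) (y, c) * K y z))"
        using that by (simp add: i') (simp add: sum_distrib_left mult.assoc)
      also have "\<dots> = (\<Sum>y\<in>Y. cnj (K x z) * S (x, c) (y, c) * K y z)"
        using that by (simp add: ci') (simp add: sum_distrib_left mult.assoc)
      finally show "(\<Sum>d\<in>C. \<Sum>y\<in>Y. \<Sum>e\<in>C. cnj (L (x, d) (z, c)) * S (x, d) (y, e) * L (y, e) (z, c))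
         = (\<Sum>y\<in>Y. cnj (K x z) * S (x, c) (y, c) * K y z)" .
    qed
    show ?thesis unfolding p by (rule sum.cong[OF refl], rule sum.cong[OF refl], rule *)
  qed
  also have "\<dots> = (\<Sum>z\<in>Y. \<Sum>x\<in>Y. \<Sum>y\<in>Y. \<Sum>c\<in>C. cnj (K x z) * S (x, c) (y, c) * K y z)"
    by (rule sum.cong[OF refl], rule sum_rotate)
  finally have 2: "(\<Sum>z\<in>Y \<times> C. \<Sum>x\<in>Y \<times> C. \<Sum>y\<in>Y \<times> C. cnj (L x z) * S x y * L y z)
      = (\<Sum>z\<in>Y. \<Sum>x\<in>Y. \<Sum>y\<in>Y. cnj (K x z) * ptrace C S x y * K y z)"
    by (simp add: ptrace_def sum_distrib_left sum_distrib_right)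
  have "(\<Sum>x\<in>Y \<times> C. \<Sum>y\<in>Y \<times> C. \<Sum>z\<in>Y \<times> C. cnj (L x z) * L x y * R y z)
      = (\<Sum>x\<in>Y. \<Sum>c\<in>C. \<Sum>y\<in>Y. \<Sum>z\<in>Y. cnj (K x z) * K x y * R (y, c) (z, c))"
  proof -
    have *: "(\<Sum>y\<in>Y. \<Sum>d\<in>C. \<Sum>z\<in>Y. \<Sum>e\<in>C. cnj (L (x, c) (z, e)) * L (x, c) (y, d) * R (y, d) (z, e))
        = (\<Sum>y\<in>Y. \<Sum>z\<in>Y. cnj (K x z) * K x y * R (y, c) (z, c))" if "c \<in> C" for x c
    proof (rule sum.cong[OF refl])
      fix y
      have "(\<Sum>d\<in>C. \<Sum>z\<in>Y. \<Sum>e\<in>C. cnj (L (x, c) (z, e)) * L (x, c) (y, d) * R (y, d) (z, e))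
         = (\<Sum>d\<in>C. L (x, c) (y, d) * (\<Sum>z\<in>Y. cnj (K x z) * R (y, d) (z, c)))"
        using that by (simp add: ci mult.assoc) (simp add: sum_distrib_left mult_ac)
      also have "\<dots> = (\<Sum>z\<in>Y. cnj (K x z) * K x y * R (y, c) (z, c))"
        using that by (simp add: i) (simp add: sum_distrib_left mult_ac)
      finally show "(\<Sum>d\<in>C. \<Sum>z\<in>Y. \<Sum>e\<in>C. cnj (L (x, c) (z, e)) * L (x, c) (y, d) * R (y, d) (z, e))
         = (\<Sum>z\<in>Y. cnj (K x z) * K x y * R (y, c) (z, c))" .
    qed
    show ?thesis unfolding p by (rule sum.cong[OF refl], rule sum.cong[OF refl], rule *)
  qed
  also have "\<dots> = (\<Sum>x\<in>Y. \<Sum>y\<in>Y. \<Sum>z\<in>Y. \<Sum>c\<in>C. cnj (K x z) * K x y * R (y, c) (z, c))"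
    by (rule sum.cong[OF refl], rule sum_rotate)
  finally have 3: "(\<Sum>x\<in>Y \<times> C. \<Sum>y\<in>Y \<times> C. \<Sum>z\<in>Y \<times> C. cnj (L x z) * L x y * R y z)
      = (\<Sum>x\<in>Y. \<Sum>y\<in>Y. \<Sum>z\<in>Y. cnj (K x z) * K x y * ptrace C R y z)"
    by (simp add: ptrace_def sum_distrib_left)
  show ?thesis unfolding rel_form_def L_def[symmetric] 1 2 3 ..
qed

section \<open>From resolvent sums to relative entropies\<close>

text \<open>The derivative of \<open>G\<close> is the difference of the resolvent sums, so
  \<open>G\<close> is nondecreasing on t \<ge> 0. Comparing its value at 0 with its limit at
  infinity gives the claim.\<close>

lemma sum_log_ratio_mono:
  fixes w p q :: "'i \<Rightarrow> real" and w' p' q' :: "'j \<Rightarrow> real"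
  assumes p: "\<And>i. i \<in> I \<Longrightarrow> p i > 0" and q: "\<And>i. i \<in> I \<Longrightarrow> q i > 0"
    and p': "\<And>j. j \<in> J \<Longrightarrow> p' j > 0" and q': "\<And>j. j \<in> J \<Longrightarrow> q' j > 0"
    and total: "(\<Sum>i\<in>I. w i * p i) = (\<Sum>j\<in>J. w' j * p' j)"
    and le: "\<And>t. t \<ge> 0 \<Longrightarrow>
      (\<Sum>j\<in>J. w' j * (p' j)\<^sup>2 / (q' j + t * p' j)) \<le> (\<Sum>i\<in>I. w i * (p i)\<^sup>2 / (q i + t * p i))"
  shows "(\<Sum>j\<in>J. w' j * (p' j * (ln (p' j) - ln (q' j)))) \<le> (\<Sum>i\<in>I. w i * (p i * (ln (p i) - ln (q i))))"
proof -
  define G where "G = (\<lambda>t. (\<Sum>i\<in>I. w i * p i * ln (q i + t * p i))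
     - (\<Sum>j\<in>J. w' j * p' j * ln (q' j + t * p' j)))"
  \<comment> \<open>\<open>G\<close> with \<open>ln t\<close> split off every logarithm. The two
    multiples of \<open>ln t\<close> cancel by \<open>total\<close>, so \<open>H\<close> agrees with
    \<open>G\<close> for positive \<open>t\<close> but visibly converges.\<close>
  define H where "H = (\<lambda>t. (\<Sum>i\<in>I. w i * p i * ln (q i / t + p i))
     - (\<Sum>j\<in>J. w' j * p' j * ln (q' j / t + p' j)))"
  have pos: "q i + t * p i > 0" if "i \<in> I" "t \<ge> 0" for i t
    using p[OF that(1)] q[OF that(1)] that(2) by (simp add: add_pos_nonneg)
  have pos': "q' i + t * p' i > 0" if "i \<in> J" "t \<ge> 0" for i t
    using p'[OF that(1)] q'[OF that(1)] that(2) by (simp add: add_pos_nonneg)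
  have G0: "G 0 \<le> G t" if "t \<ge> 0" for t
  proof (rule DERIV_nonneg_imp_nondecreasing[OF that])
    fix s :: real assume s: "0 \<le> s" "s \<le> t"
    have 1: "((\<lambda>t. \<Sum>i\<in>I. w i * p i * ln (q i + t * p i)) has_real_derivative
       (\<Sum>i\<in>I. w i * (p i)\<^sup>2 / (q i + s * p i))) (at s)"
      by (rule DERIV_sum) (use pos s in \<open>auto intro!: derivative_eq_intros simp: power2_eq_square\<close>)
    have 2: "((\<lambda>t. \<Sum>i\<in>J. w' i * p' i * ln (q' i + t * p' i)) has_real_derivative
       (\<Sum>i\<in>J. w' i * (p' i)\<^sup>2 / (q' i + s * p' i))) (at s)"
      by (rule DERIV_sum) (use pos' s in \<open>auto intro!: derivative_eq_intros simp: power2_eq_square\<close>)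
    show "\<exists>y. (G has_real_derivative y) (at s) \<and> 0 \<le> y"
      using DERIV_diff[OF 1 2] le[OF s(1)] unfolding G_def
      by (intro exI[of _ "(\<Sum>i\<in>I. w i * (p i)\<^sup>2 / (q i + s * p i))
        - (\<Sum>i\<in>J. w' i * (p' i)\<^sup>2 / (q' i + s * p' i))"]) auto
  qed
  have GH: "G t = H t" if t: "t > 0" for t
  proof -
    have "w i * p i * ln (q i + t * p i) = w i * p i * ln t + w i * p i * ln (q i / t + p i)" if "i \<in> I" for i
    proof -
      have "q i + t * p i = t * (q i / t + p i)" using t by (simp add: field_simps)
      then show ?thesis using ln_mult_pos[of t "q i / t + p i"] t p[OF that] q[OF that]
        by (simp add: add_pos_pos distrib_left)
    qed
    moreover have "w' i * p' i * ln (q' i + t * p' i) = w' i * p' i * ln t + w' i * p' i * ln (q' i / t + p' i)"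
      if "i \<in> J" for i
    proof -
      have "q' i + t * p' i = t * (q' i / t + p' i)" using t by (simp add: field_simps)
      then show ?thesis using ln_mult_pos[of t "q' i / t + p' i"] t p'[OF that] q'[OF that]
        by (simp add: add_pos_pos distrib_left)
    qed
    ultimately show ?thesis using total
      by (simp add: G_def H_def sum.distrib flip: sum_distrib_right)
  qed
  \<comment> \<open>The quotients \<open>q i / t\<close> and \<open>q' j / t\<close> tend to 0,
    leaving only the logarithms of the \<open>p i\<close> and \<open>p' j\<close>.\<close>
  have "(H \<longlongrightarrow> (\<Sum>i\<in>I. w i * p i * ln (0 + p i)) - (\<Sum>j\<in>J. w' j * p' j * ln (0 + p' j))) at_top"
    unfolding H_def using p p'
    by (intro tendsto_intros tendsto_divide_0[OF tendsto_const] filterlim_at_top_imp_at_infinity filterlim_ident)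
       force+
  moreover have "eventually (\<lambda>t. G 0 \<le> H t) at_top"
    using eventually_gt_at_top[of 0] by eventually_elim (metis G0 GH less_imp_le)
  ultimately have "G 0 \<le> (\<Sum>i\<in>I. w i * p i * ln (0 + p i)) - (\<Sum>j\<in>J. w' j * p' j * ln (0 + p' j))"
    by (intro tendsto_lowerbound[of H _ at_top]) auto
  then show ?thesis
    by (simp add: G_def right_diff_distrib sum_subtractf mult.assoc)
qed

text \<open>For fixed \<open>j\<close> the squared overlaps sum to 1, which leaves the spectrum of
  \<open>R\<close> in the first term. Weighted by the \<open>p j\<close>, they sum over
  \<open>j\<close> to the diagonal entries of \<open>R\<close> in the basis \<open>\<psi>\<close>.
  The first right side is thus Tr(R ln R) - Tr(R ln S).\<close>

lemma rel_entropy_eq: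
  assumes fX: "finite X" and R: "eigenbasis X R \<phi> p" and S: "eigenbasis X S \<psi> q"
  shows "(\<Sum>(j, k)\<in>X \<times> X. (cmod (op_inner X (\<psi> k) (\<phi> j)))\<^sup>2 * (p j * (ln (p j) - ln (q k))))
    = (\<Sum>j\<in>X. p j * ln (p j)) - (\<Sum>k\<in>X. Re (op_inner X (\<psi> k) (op_apply X R (\<psi> k))) * ln (q k))"
    and "(\<Sum>(j, k)\<in>X \<times> X. (cmod (op_inner X (\<psi> k) (\<phi> j)))\<^sup>2 * p j) = (\<Sum>j\<in>X. p j)"
proof -
  define W where "W = (\<lambda>j k. (cmod (op_inner X (\<psi> k) (\<phi> j)))\<^sup>2)"
  have W1: "(\<Sum>k\<in>X. W j k) = 1" if "j \<in> X" for j
  proof -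
    have "(\<Sum>k\<in>X. W j k) = (\<Sum>x\<in>X. (cmod (\<phi> j x))\<^sup>2)"
      unfolding W_def by (rule parseval_norm[OF fX S])
    also have "\<dots> = 1" using eigenbasisD(1)[OF R that that]
      unfolding op_inner_self by (simp del: of_real_sum of_real_power)
    finally show ?thesis .
  qed
  have Wq: "Re (op_inner X (\<psi> k) (op_apply X R (\<psi> k))) = (\<Sum>j\<in>X. W j k * p j)" for k
  proof -
    have "op_inner X (\<psi> k) (op_apply X R (\<psi> k))
        = (\<Sum>j\<in>X. of_real (p j) * (op_inner X (\<psi> k) (\<phi> j) * cnj (op_inner X (\<psi> k) (\<phi> j))))"
      unfolding eigenbasis_inner_apply[OF fX R] op_inner_cnj by (simp add: mult.assoc)
    also have "\<dots> = of_real (\<Sum>j\<in>X. W j k * p j)"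
      by (simp add: W_def complex_norm_square mult.commute del: of_real_power)
    finally show ?thesis by simp
  qed
  have "(\<Sum>(j, k)\<in>X \<times> X. W j k * (p j * (ln (p j) - ln (q k))))
     = (\<Sum>j\<in>X. (\<Sum>k\<in>X. W j k) * (p j * ln (p j))) - (\<Sum>j\<in>X. \<Sum>k\<in>X. W j k * p j * ln (q k))"
    by (simp add: sum.cartesian_product[symmetric] right_diff_distrib sum_subtractf sum_distrib_right mult.assoc)
  also have "(\<Sum>j\<in>X. \<Sum>k\<in>X. W j k * p j * ln (q k)) = (\<Sum>k\<in>X. (\<Sum>j\<in>X. W j k * p j) * ln (q k))"
    unfolding sum_distrib_right by (rule sum.swap)
  finally show "(\<Sum>(j, k)\<in>X \<times> X. (cmod (op_inner X (\<psi> k) (\<phi> j)))\<^sup>2 * (p j * (ln (p j) - ln (q k))))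
    = (\<Sum>j\<in>X. p j * ln (p j)) - (\<Sum>k\<in>X. Re (op_inner X (\<psi> k) (op_apply X R (\<psi> k))) * ln (q k))"
    by (simp add: W1 Wq) (simp add: W_def)
  have "(\<Sum>(j, k)\<in>X \<times> X. W j k * p j) = (\<Sum>j\<in>X. (\<Sum>k\<in>X. W j k) * p j)"
    by (simp add: sum.cartesian_product[symmetric] sum_distrib_right)
  then show "(\<Sum>(j, k)\<in>X \<times> X. (cmod (op_inner X (\<psi> k) (\<phi> j)))\<^sup>2 * p j) = (\<Sum>j\<in>X. p j)"
    by (simp add: W1) (simp add: W_def)
qed

text \<open>The optimal \<open>K\<close> for the partial traces gives the same value of the form as
  K \<otimes> 1 on the larger space, where it is at most the resolvent sum. The comparison holds for
  all t \<ge> 0 and passes to logarithms by \<open>sum_log_ratio_mono\<close>.\<close>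

lemma rel_entropy_ptrace_mono:
  assumes fin: "finite Y" "finite C"
    and R: "eigenbasis (Y \<times> C) R \<phi> p" and S: "eigenbasis (Y \<times> C) S \<psi> q"
    and R': "eigenbasis Y (ptrace C R) \<phi>' p'" and S': "eigenbasis Y (ptrace C S) \<psi>' q'"
    and p: "\<And>j. j \<in> Y \<times> C \<Longrightarrow> p j > 0" and q: "\<And>j. j \<in> Y \<times> C \<Longrightarrow> q j > 0"
    and p': "\<And>j. j \<in> Y \<Longrightarrow> p' j > 0" and q': "\<And>j. j \<in> Y \<Longrightarrow> q' j > 0"
  shows "(\<Sum>j\<in>Y. p' j * ln (p' j))
      - (\<Sum>k\<in>Y. Re (op_inner Y (\<psi>' k) (op_apply Y (ptrace C R) (\<psi>' k))) * ln (q' k))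
    \<le> (\<Sum>j\<in>Y \<times> C. p j * ln (p j))
      - (\<Sum>k\<in>Y \<times> C. Re (op_inner (Y \<times> C) (\<psi> k) (op_apply (Y \<times> C) R (\<psi> k))) * ln (q k))"
proof -
  let ?X = "Y \<times> C"
  have fX: "finite ?X" using fin by simp
  have "op_trace ?X R = op_trace Y (ptrace C R)"
    by (simp add: op_trace_def ptrace_def sum.cartesian_product)
  then have tr: "(\<Sum>j\<in>Y. p' j) = (\<Sum>j\<in>?X. p j)"
    using eigenbasis_trace[OF fX R] eigenbasis_trace[OF fin(1) R'] by (simp del: of_real_sum)
  have le: "(\<Sum>j\<in>Y. \<Sum>k\<in>Y. (cmod (op_inner Y (\<psi>' k) (\<phi>' j)))\<^sup>2 * (p' j)\<^sup>2 / (q' k + t * p' j))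
     \<le> (\<Sum>j\<in>?X. \<Sum>k\<in>?X. (cmod (op_inner ?X (\<psi> k) (\<phi> j)))\<^sup>2 * (p j)\<^sup>2 / (q k + t * p j))"
    if t: "t \<ge> 0" for t
  proof -
    obtain K where K: "rel_form Y t (ptrace C R) (ptrace C S) K
      = (\<Sum>j\<in>Y. \<Sum>k\<in>Y. (cmod (op_inner Y (\<psi>' k) (\<phi>' j)))\<^sup>2 * (p' j)\<^sup>2 / (q' k + t * p' j))"
      using rel_form_sup(2)[OF fin(1) R' S' p' q' t] by blast
    show ?thesis
      unfolding K[symmetric] rel_form_tensor_one[OF fin(2), symmetric]
      by (rule rel_form_sup(1)[OF fX R S p q t])
  qed
  \<comment> \<open>The pairs \<open>(j, k)\<close> serve as a single index, with the squared
    overlaps as weights.\<close>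
  have "(\<Sum>a\<in>Y \<times> Y. (\<lambda>(j, k). (cmod (op_inner Y (\<psi>' k) (\<phi>' j)))\<^sup>2) a
        * ((p' \<circ> fst) a * (ln ((p' \<circ> fst) a) - ln ((q' \<circ> snd) a))))
    \<le> (\<Sum>a\<in>?X \<times> ?X. (\<lambda>(j, k). (cmod (op_inner ?X (\<psi> k) (\<phi> j)))\<^sup>2) a
        * ((p \<circ> fst) a * (ln ((p \<circ> fst) a) - ln ((q \<circ> snd) a))))"
  proof (rule sum_log_ratio_mono)
    show "(\<Sum>a\<in>?X \<times> ?X. (\<lambda>(j, k). (cmod (op_inner ?X (\<psi> k) (\<phi> j)))\<^sup>2) a * (p \<circ> fst) a)
      = (\<Sum>a\<in>Y \<times> Y. (\<lambda>(j, k). (cmod (op_inner Y (\<psi>' k) (\<phi>' j)))\<^sup>2) a * (p' \<circ> fst) a)"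
      using rel_entropy_eq(2)[OF fX R S] rel_entropy_eq(2)[OF fin(1) R' S'] tr
      by (simp add: case_prod_unfold)
    show "(\<Sum>a\<in>Y \<times> Y. (\<lambda>(j, k). (cmod (op_inner Y (\<psi>' k) (\<phi>' j)))\<^sup>2) a * ((p' \<circ> fst) a)\<^sup>2
          / ((q' \<circ> snd) a + t * (p' \<circ> fst) a))
      \<le> (\<Sum>a\<in>?X \<times> ?X. (\<lambda>(j, k). (cmod (op_inner ?X (\<psi> k) (\<phi> j)))\<^sup>2) a * ((p \<circ> fst) a)\<^sup>2
          / ((q \<circ> snd) a + t * (p \<circ> fst) a))" if "t \<ge> 0" for t
      using le[OF that] unfolding sum.cartesian_product by (simp add: case_prod_unfold)
  qed (use p q p' q' in auto)
  then show ?thesis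
    unfolding rel_entropy_eq(1)[OF fX R S, symmetric] rel_entropy_eq(1)[OF fin(1) R' S', symmetric]
    by (simp add: case_prod_unfold)
qed

section \<open>Tensoring with the identity\<close>

text \<open>Used for operators and for bases alike: \<open>one_tensor N\<close> is 1 \<otimes> N,
  and \<open>one_tensor \<psi> (a, k)\<close> is the product of the standard basis vector at
  \<open>a\<close> with \<open>\<psi> k\<close>.\<close>

definition one_tensor :: "('z \<Rightarrow> 'z \<Rightarrow> complex) \<Rightarrow> 'a \<times> 'z \<Rightarrow> 'a \<times> 'z \<Rightarrow> complex" where
  "one_tensor N = (\<lambda>x y. if fst x = fst y then N (snd x) (snd y) else 0)"

lemma op_inner_one_tensor:
  assumes "finite A" "a \<in> A"
  shows "op_inner (A \<times> Z) (one_tensor \<psi> (a, k)) u = op_inner Z (\<psi> k) (\<lambda>z. u (a, z))"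
proof -
  have "op_inner (A \<times> Z) (one_tensor \<psi> (a, k)) u
     = (\<Sum>b\<in>A. if a = b then (\<Sum>z\<in>Z. cnj (\<psi> k z) * u (b, z)) else 0)"
    unfolding op_inner_def by (simp add: sum.cartesian_product' one_tensor_def if_distrib if_distribR cong: if_cong)
       (intro sum.cong refl, auto)
  then show ?thesis using assms by (simp add: op_inner_def)
qed

lemma op_apply_one_tensor_vector:
  assumes "finite A" "a \<in> A"
  shows "op_apply (A \<times> Z) R (one_tensor \<psi> (a, k)) x = (\<Sum>z\<in>Z. R x (a, z) * \<psi> k z)"
proof -
  have "op_apply (A \<times> Z) R (one_tensor \<psi> (a, k)) x
     = (\<Sum>b\<in>A. if a = b then (\<Sum>z\<in>Z. R x (b, z) * \<psi> k z) else 0)"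
    unfolding op_apply_def by (simp add: sum.cartesian_product' one_tensor_def if_distrib if_distribR cong: if_cong)
       (intro sum.cong refl, auto)
  then show ?thesis using assms by simp
qed

lemma eigenbasis_one_tensor:
  assumes fA: "finite A" and eb: "eigenbasis Z N \<psi> q"
  shows "eigenbasis (A \<times> Z) (one_tensor N) (one_tensor \<psi>) (\<lambda>k. q (snd k))"
proof -
  have "op_inner (A \<times> Z) (one_tensor \<psi> (a, k)) (one_tensor \<psi> (b, l)) = (if (a, k) = (b, l) then 1 else 0)"
    if "a \<in> A" "b \<in> A" "k \<in> Z" "l \<in> Z" for a b k l
    using that eigenbasisD(1)[OF eb that(3,4)]
    unfolding op_inner_one_tensor[OF fA that(1)] by (cases "a = b") (auto simp: one_tensor_def op_inner_def)
  moreover have "op_apply (A \<times> Z) (one_tensor N) (one_tensor \<psi> (a, k)) (b, z)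
      = of_real (q k) * one_tensor \<psi> (a, k) (b, z)" if "a \<in> A" "b \<in> A" "k \<in> Z" "z \<in> Z" for a b k z
    using that eigenbasisD(2)[OF eb that(3,4)]
    unfolding op_apply_one_tensor_vector[OF fA that(1)] by (cases "a = b") (auto simp: one_tensor_def op_apply_def)
  ultimately show ?thesis by (auto simp: eigenbasis_def)
qed

text \<open>For the partial trace N of R over \<open>A\<close> this says Tr(R ln(1 \<otimes> N)) =
  Tr(N ln N): the product vectors see only the diagonal blocks of \<open>R\<close>, and these sum to
  N. It turns a relative entropy into a difference of entropies.\<close>

lemma sum_log_one_tensor:
  assumes fA: "finite A" and eb: "eigenbasis Z (\<lambda>y z. \<Sum>a\<in>A. R (a, y) (a, z)) \<psi> q"
  shows "(\<Sum>k\<in>A \<times> Z. Re (op_inner (A \<times> Z) (one_tensor \<psi> k) (op_apply (A \<times> Z) R (one_tensor \<psi> k)))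
      * ln (q (snd k))) = (\<Sum>k\<in>Z. q k * ln (q k))"
proof -
  have e: "(\<Sum>a\<in>A. op_inner (A \<times> Z) (one_tensor \<psi> (a, k)) (op_apply (A \<times> Z) R (one_tensor \<psi> (a, k))))
     = of_real (q k)" if k: "k \<in> Z" for k
  proof -
    let ?N = "\<lambda>y z. \<Sum>a\<in>A. R (a, y) (a, z)"
    have "(\<Sum>a\<in>A. op_inner (A \<times> Z) (one_tensor \<psi> (a, k)) (op_apply (A \<times> Z) R (one_tensor \<psi> (a, k))))
      = (\<Sum>a\<in>A. \<Sum>y\<in>Z. \<Sum>z\<in>Z. cnj (\<psi> k y) * (R (a, y) (a, z) * \<psi> k z))"
      by (intro sum.cong refl)
         (simp add: op_inner_one_tensor[OF fA] op_apply_one_tensor_vector[OF fA], simp add: op_inner_def sum_distrib_left)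
    also have "\<dots> = (\<Sum>y\<in>Z. \<Sum>z\<in>Z. \<Sum>a\<in>A. cnj (\<psi> k y) * (R (a, y) (a, z) * \<psi> k z))"
      by (rule sum_rotate)
    also have "\<dots> = op_inner Z (\<psi> k) (op_apply Z ?N (\<psi> k))"
      by (simp add: op_inner_def op_apply_def sum_distrib_left sum_distrib_right)
    also have "\<dots> = op_inner Z (\<psi> k) (\<lambda>z. of_real (q k) * \<psi> k z)"
      using eigenbasisD(2)[OF eb k] by (intro op_inner_cong) auto
    also have "\<dots> = of_real (q k)"
      by (simp add: op_inner_scale_right eigenbasisD(1)[OF eb k k])
    finally show ?thesis .
  qed
  have "(\<Sum>k\<in>A \<times> Z. Re (op_inner (A \<times> Z) (one_tensor \<psi> k) (op_apply (A \<times> Z) R (one_tensor \<psi> k)))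
      * ln (q (snd k)))
    = (\<Sum>a\<in>A. \<Sum>k\<in>Z. Re (op_inner (A \<times> Z) (one_tensor \<psi> (a, k)) (op_apply (A \<times> Z) R (one_tensor \<psi> (a, k))))
      * ln (q k))"
    by (simp add: sum.cartesian_product')
  also have "\<dots> = (\<Sum>k\<in>Z. Re (\<Sum>a\<in>A. op_inner (A \<times> Z) (one_tensor \<psi> (a, k))
      (op_apply (A \<times> Z) R (one_tensor \<psi> (a, k)))) * ln (q k))"
    unfolding Re_sum sum_distrib_right by (rule sum.swap)
  also have "\<dots> = (\<Sum>k\<in>Z. q k * ln (q k))" by (simp add: e)
  finally show ?thesis .
qed

text \<open>Each side is a relative entropy with respect to an operator 1 \<otimes> N, rewritten by
  \<open>sum_log_one_tensor\<close>; the inequality is monotonicity under the trace over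
  \<open>C\<close>.\<close>

lemma strong_subadditivity_product:
  fixes R :: "'a \<times> ('b \<times> 'c) \<Rightarrow> 'a \<times> ('b \<times> 'c) \<Rightarrow> complex"
  assumes fin: "finite A" "finite B" "finite C"
    and R: "eigenbasis (A \<times> (B \<times> C)) R \<phi> p"
    and AB: "eigenbasis (A \<times> B) (\<lambda>(a, b) (a', b'). \<Sum>c\<in>C. R (a, b, c) (a', b', c)) \<phi>' p'"
    and BC: "eigenbasis (B \<times> C) (\<lambda>y z. \<Sum>a\<in>A. R (a, y) (a, z)) \<psi> q"
    and B: "eigenbasis B (\<lambda>b b'. \<Sum>a\<in>A. \<Sum>c\<in>C. R (a, b, c) (a, b', c)) \<psi>' q'"
    and pos: "\<And>j. j \<in> A \<times> (B \<times> C) \<Longrightarrow> p j > 0" "\<And>j. j \<in> A \<times> B \<Longrightarrow> p' j > 0"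
      "\<And>j. j \<in> B \<times> C \<Longrightarrow> q j > 0" "\<And>j. j \<in> B \<Longrightarrow> q' j > 0"
  shows "(\<Sum>j\<in>A \<times> B. p' j * ln (p' j)) - (\<Sum>k\<in>B. q' k * ln (q' k))
    \<le> (\<Sum>j\<in>A \<times> (B \<times> C). p j * ln (p j)) - (\<Sum>k\<in>B \<times> C. q k * ln (q k))"
proof -
  \<comment> \<open>Reassociates the triple, since \<open>ptrace\<close> removes the second
    component of a pair and \<open>one_tensor\<close> needs \<open>A\<close> as the first.\<close>
  define g :: "('a \<times> 'b) \<times> 'c \<Rightarrow> 'a \<times> ('b \<times> 'c)" where "g = (\<lambda>((a, b), c). (a, b, c))"
  define RBC where "RBC = (\<lambda>y z. \<Sum>a\<in>A. R (a, y) (a, z))"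
  let ?X = "A \<times> (B \<times> C)" and ?X2 = "(A \<times> B) \<times> C"
  have g: "bij_betw g ?X2 ?X"
    by (rule bij_betw_byWitness[where f' = "\<lambda>(a, b, c). ((a, b), c)"]) (auto simp: g_def)
  note R2 = eigenbasis_reindex[OF R g]
  note S2 = eigenbasis_reindex[OF eigenbasis_one_tensor[OF fin(1) BC[folded RBC_def]] g]
  have pR: "ptrace C (\<lambda>x y. R (g x) (g y)) = (\<lambda>(a, b) (a', b'). \<Sum>c\<in>C. R (a, b, c) (a', b', c))"
    by (auto simp: ptrace_def g_def fun_eq_iff)
  \<comment> \<open>Tracing out \<open>C\<close> leaves the identity on \<open>A\<close> untouched
    and takes the marginal on \<open>B \<times> C\<close> to the one on \<open>B\<close>.\<close>
  have pS: "ptrace C (\<lambda>x y. one_tensor RBC (g x) (g y))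
    = one_tensor (\<lambda>b b'. \<Sum>a\<in>A. \<Sum>c\<in>C. R (a, b, c) (a, b', c))"
    by (auto simp: ptrace_def g_def fun_eq_iff one_tensor_def RBC_def intro: sum.swap)
  have "(\<Sum>j\<in>A \<times> B. p' j * ln (p' j))
      - (\<Sum>k\<in>A \<times> B. Re (op_inner (A \<times> B) (one_tensor \<psi>' k) (op_apply (A \<times> B)
          (ptrace C (\<lambda>x y. R (g x) (g y))) (one_tensor \<psi>' k))) * ln (q' (snd k)))
    \<le> (\<Sum>j\<in>?X2. p (g j) * ln (p (g j)))
      - (\<Sum>k\<in>?X2. Re (op_inner ?X2 (\<lambda>y. one_tensor \<psi> (g k) (g y)) (op_apply ?X2 (\<lambda>x y. R (g x) (g y))
          (\<lambda>y. one_tensor \<psi> (g k) (g y)))) * ln (q (snd (g k))))"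
    using fin pos AB eigenbasis_one_tensor[OF fin(1) B]
    by (intro rel_entropy_ptrace_mono[OF _ fin(3) R2 S2]) (auto simp: pR pS, auto simp: g_def)
  moreover have "(\<Sum>k\<in>A \<times> B. Re (op_inner (A \<times> B) (one_tensor \<psi>' k) (op_apply (A \<times> B)
          (ptrace C (\<lambda>x y. R (g x) (g y))) (one_tensor \<psi>' k))) * ln (q' (snd k))) = (\<Sum>k\<in>B. q' k * ln (q' k))"
    unfolding pR by (rule sum_log_one_tensor[OF fin(1)]) (use B in simp)
  moreover have "(\<Sum>j\<in>?X2. p (g j) * ln (p (g j))) = (\<Sum>j\<in>?X. p j * ln (p j))"
    by (rule sum.reindex_bij_betw[OF g])
  moreover have "(\<Sum>k\<in>?X2. Re (op_inner ?X2 (\<lambda>y. one_tensor \<psi> (g k) (g y)) (op_apply ?X2 (\<lambda>x y. R (g x) (g y))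
          (\<lambda>y. one_tensor \<psi> (g k) (g y)))) * ln (q (snd (g k)))) = (\<Sum>k\<in>B \<times> C. q k * ln (q k))"
  proof -
    have "(\<Sum>k\<in>?X2. Re (op_inner ?X2 (\<lambda>y. one_tensor \<psi> (g k) (g y)) (op_apply ?X2 (\<lambda>x y. R (g x) (g y))
          (\<lambda>y. one_tensor \<psi> (g k) (g y)))) * ln (q (snd (g k))))
       = (\<Sum>k\<in>?X2. Re (op_inner ?X (one_tensor \<psi> (g k)) (op_apply ?X R (one_tensor \<psi> (g k)))) * ln (q (snd (g k))))"
      by (simp only: op_apply_reindex[OF g] op_inner_reindex[OF g])
    also have "\<dots> = (\<Sum>k\<in>?X. Re (op_inner ?X (one_tensor \<psi> k) (op_apply ?X R (one_tensor \<psi> k))) * ln (q (snd k)))"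
      by (rule sum.reindex_bij_betw[OF g])
    also have "\<dots> = (\<Sum>k\<in>B \<times> C. q k * ln (q k))"
      by (rule sum_log_one_tensor[OF fin(1) BC])
    finally show ?thesis .
  qed
  ultimately show ?thesis by simp
qed

section \<open>Strong subadditivity for marginals\<close>

lemma override_on_cfg:
  assumes "x \<in> cfg d P" "z \<in> cfg d Q"
  shows "override_on z x P \<in> cfg d (P \<union> Q)"
  using assms by (auto simp: cfg_def override_on_def PiE_def extensional_def Pi_def)

text \<open>On the level of bases this identifies the space of a disjoint union with the tensor
  product of the two spaces.\<close>

lemma bij_betw_override_on:
  assumes "P \<inter> Q = {}"
  shows "bij_betw (\<lambda>(x, z). override_on z x P) (cfg d P \<times> cfg d Q) (cfg d (P \<union> Q))"
proof (rule bij_betw_byWitness[where f' = "\<lambda>\<xi>. (restrict \<xi> P, restrict \<xi> Q)"])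
  show "\<forall>a\<in>cfg d P \<times> cfg d Q. (restrict (case a of (x, z) \<Rightarrow> override_on z x P) P,
      restrict (case a of (x, z) \<Rightarrow> override_on z x P) Q) = a"
    using assms by (fastforce simp: cfg_def override_on_def PiE_def extensional_def fun_eq_iff)
  show "\<forall>a'\<in>cfg d (P \<union> Q). (case (restrict a' P, restrict a' Q) of (x, z) \<Rightarrow> override_on z x P) = a'"
    by (fastforce simp: cfg_def override_on_def PiE_def extensional_def fun_eq_iff)
  show "(\<lambda>(x, z). override_on z x P) ` (cfg d P \<times> cfg d Q) \<subseteq> cfg d (P \<union> Q)"
    using override_on_cfg by fastforce
  show "(\<lambda>\<xi>. (restrict \<xi> P, restrict \<xi> Q)) ` cfg d (P \<union> Q) \<subseteq> cfg d P \<times> cfg d Q"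
    by (auto simp: cfg_def)
qed

lemma sum_cfg_Un:
  assumes "P \<inter> Q = {}"
  shows "(\<Sum>\<xi>\<in>cfg d (P \<union> Q). F \<xi>) = (\<Sum>x\<in>cfg d P. \<Sum>z\<in>cfg d Q. F (override_on z x P))"
  using sum.reindex_bij_betw[OF bij_betw_override_on[OF assms], of F d]
  by (simp add: sum.cartesian_product case_prod_unfold)

lemma finite_cfg: "finite A \<Longrightarrow> finite (cfg d A)"
  by (auto simp: cfg_def intro: finite_PiE)

section \<open>Marginals of a state\<close>

lemma marginal_ops: "marginal d V \<rho> A \<in> ops (cfg d A)"
  by (auto simp: marginal_def ops_def)

text \<open>Partial traces compose: \<open>V - P\<close> is traced out in two stages, first the part
  outside \<open>P \<union> Q\<close>, then \<open>Q\<close>.\<close>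

lemma marginal_split:
  assumes PQ: "P \<inter> Q = {}" "P \<union> Q \<subseteq> V" and xy: "x \<in> cfg d P" "y \<in> cfg d P"
  shows "marginal d V \<rho> P x y
    = (\<Sum>z\<in>cfg d Q. marginal d V \<rho> (P \<union> Q) (override_on z x P) (override_on z y P))"
proof -
  have V: "V - P = Q \<union> (V - (P \<union> Q))" using PQ by auto
  have o: "override_on (override_on w z Q) u P = override_on w (override_on z u P) (P \<union> Q)" for w z u
    by (auto simp: override_on_def fun_eq_iff)
  have "marginal d V \<rho> P x y = (\<Sum>\<xi>\<in>cfg d (V - P). \<rho> (override_on \<xi> x P) (override_on \<xi> y P))"
    using xy by (simp add: marginal_def)
  also have "\<dots> = (\<Sum>z\<in>cfg d Q. \<Sum>w\<in>cfg d (V - (P \<union> Q)).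
      \<rho> (override_on (override_on w z Q) x P) (override_on (override_on w z Q) y P))"
    by (subst V, rule sum_cfg_Un) auto
  also have "\<dots> = (\<Sum>z\<in>cfg d Q. marginal d V \<rho> (P \<union> Q) (override_on z x P) (override_on z y P))"
    using xy by (intro sum.cong refl) (simp add: marginal_def o override_on_cfg)
  finally show ?thesis .
qed

text \<open>A trace equal to 1 rules out an empty basis, and a configuration of \<open>V\<close>
  restricts to one of \<open>A\<close>.\<close>

lemma cfg_nonempty:
  assumes "\<rho> \<in> pos_states (cfg d V)" "A \<subseteq> V"
  shows "cfg d A \<noteq> {}"
proof -
  have "cfg d V \<noteq> {}" using assms(1) by (auto simp: pos_states_def op_trace_def)
  then obtain \<xi> where "\<xi> \<in> cfg d V" by blast
  then have "restrict \<xi> A \<in> cfg d A" using assms(2) by (auto simp: cfg_def PiE_def Pi_def)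
  then show ?thesis by blast
qed

text \<open>The quadratic form of the marginal at \<open>u\<close> is a nonempty sum of values of
  the form of \<open>\<rho>\<close>, at the nonzero product vectors of \<open>u\<close> with the
  basis vectors of the complement.\<close>

lemma marginal_positive_definite:
  assumes fV: "finite V" and \<rho>: "\<rho> \<in> pos_states (cfg d V)" and A: "A \<subseteq> V"
  shows "positive_definite (cfg d A) (marginal d V \<rho> A)"
  unfolding positive_definite_def
proof (intro conjI ballI impI)
  have sa: "self_adjoint \<rho>"
    and pd: "\<And>u. u \<in> vecs (cfg d V) \<Longrightarrow> u \<noteq> (\<lambda>x. 0) \<Longrightarrow> Re (op_inner (cfg d V) u (op_apply (cfg d V) \<rho> u)) > 0"
    using \<rho> by (auto simp: pos_states_def positive_definite_def)
  have "cnj (\<rho> x y) = \<rho> y x" for x y using sa unfolding self_adjoint_def by metis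
  then show "self_adjoint (marginal d V \<rho> A)"
    unfolding self_adjoint_def by (auto simp: marginal_def)
  fix u assume u: "u \<in> vecs (cfg d A)" "u \<noteq> (\<lambda>x. 0)"
  \<comment> \<open>\<open>U z\<close> is the product of \<open>u\<close> with the basis vector at
    \<open>z\<close> of the space over \<open>V - A\<close>.\<close>
  define U where "U = (\<lambda>z \<xi>. if \<xi> \<in> cfg d V \<and> restrict \<xi> (V - A) = z then u (restrict \<xi> A) else 0)"
  have UV: "A \<union> (V - A) = V" using A by auto
  have fA: "finite (cfg d (V - A))" using fV by (simp add: finite_cfg)
  have U: "U z (override_on z' x A) = (if z = z' then u x else 0)"
    if "x \<in> cfg d A" "z' \<in> cfg d (V - A)" for x z z'
  proof -
    have "override_on z' x A \<in> cfg d V" using override_on_cfg[OF that] UV by simp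
    moreover have "restrict (override_on z' x A) A = x" "restrict (override_on z' x A) (V - A) = z'"
      using that by (fastforce simp: cfg_def override_on_def PiE_def extensional_def fun_eq_iff)+
    ultimately show ?thesis by (auto simp: U_def)
  qed
  have sV: "(\<Sum>\<xi>\<in>cfg d V. F \<xi>) = (\<Sum>x\<in>cfg d A. \<Sum>z\<in>cfg d (V - A). F (override_on z x A))"
    for F :: "('a \<Rightarrow> nat) \<Rightarrow> complex"
    using sum_cfg_Un[of A "V - A" F d] UV by auto
  have ap: "op_apply (cfg d V) \<rho> (U z) \<xi> = (\<Sum>y\<in>cfg d A. \<rho> \<xi> (override_on z y A) * u y)"
    if z: "z \<in> cfg d (V - A)" for z \<xi>
  proof -
    have "op_apply (cfg d V) \<rho> (U z) \<xi> = (\<Sum>y\<in>cfg d A. \<Sum>w\<in>cfg d (V - A).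
        if z = w then \<rho> \<xi> (override_on w y A) * u y else 0)"
      unfolding op_apply_def sV by (intro sum.cong refl) (simp add: U)
    then show ?thesis using z fA by simp
  qed
  have inn: "op_inner (cfg d V) (U z) w = (\<Sum>x\<in>cfg d A. cnj (u x) * w (override_on z x A))"
    if z: "z \<in> cfg d (V - A)" for z w
  proof -
    have "op_inner (cfg d V) (U z) w = (\<Sum>x\<in>cfg d A. \<Sum>z'\<in>cfg d (V - A).
        if z = z' then cnj (u x) * w (override_on z' x A) else 0)"
      unfolding op_inner_def sV by (intro sum.cong refl) (simp add: U)
    then show ?thesis using z fA by simp
  qed
  have "op_inner (cfg d A) u (op_apply (cfg d A) (marginal d V \<rho> A) u)
     = (\<Sum>x\<in>cfg d A. \<Sum>y\<in>cfg d A. \<Sum>z\<in>cfg d (V - A).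
          cnj (u x) * (\<rho> (override_on z x A) (override_on z y A) * u y))"
    by (simp add: op_inner_def op_apply_def marginal_def sum_distrib_left sum_distrib_right)
  also have "\<dots> = (\<Sum>z\<in>cfg d (V - A). \<Sum>x\<in>cfg d A. \<Sum>y\<in>cfg d A.
          cnj (u x) * (\<rho> (override_on z x A) (override_on z y A) * u y))"
    by (rule sum_rotate[symmetric])
  also have "\<dots> = (\<Sum>z\<in>cfg d (V - A). op_inner (cfg d V) (U z) (op_apply (cfg d V) \<rho> (U z)))"
    by (intro sum.cong refl) (simp add: inn ap sum_distrib_left)
  finally have e: "op_inner (cfg d A) u (op_apply (cfg d A) (marginal d V \<rho> A) u)
    = (\<Sum>z\<in>cfg d (V - A). op_inner (cfg d V) (U z) (op_apply (cfg d V) \<rho> (U z)))" .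
  obtain x where x: "u x \<noteq> 0" using u(2) by auto
  then have xA: "x \<in> cfg d A" using u(1) by (auto simp: vecs_def)
  have "Re (op_inner (cfg d V) (U z) (op_apply (cfg d V) \<rho> (U z))) > 0" if "z \<in> cfg d (V - A)" for z
  proof (rule pd)
    show "U z \<in> vecs (cfg d V)" by (simp add: U_def vecs_def)
    show "U z \<noteq> (\<lambda>x. 0)" using U[OF xA that, of z] x by metis
  qed
  then show "0 < Re (op_inner (cfg d A) u (op_apply (cfg d A) (marginal d V \<rho> A) u))"
    unfolding e Re_sum using fA cfg_nonempty[OF \<rho>, of "V - A"] by (intro sum_pos) auto
qed

lemma entropy_eigenbasis:
  assumes "finite A" "eigenbasis (cfg d A) (marginal d V \<rho> A) \<phi> \<mu>"
  shows "entropy d V \<rho> A = - (\<Sum>j\<in>cfg d A. \<mu> j * ln (\<mu> j))"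
  unfolding entropy_def trace_mult_log[OF finite_cfg[OF assms(1)] marginal_ops assms(2)] ..

lemma marginal_eigenbasis:
  assumes "finite V" "\<rho> \<in> pos_states (cfg d V)" "A \<subseteq> V"
  obtains \<phi> \<mu> where "eigenbasis (cfg d A) (marginal d V \<rho> A) \<phi> \<mu>" "\<And>j. j \<in> cfg d A \<Longrightarrow> \<mu> j > 0"
    "entropy d V \<rho> A = - (\<Sum>j\<in>cfg d A. \<mu> j * ln (\<mu> j))"
proof -
  have fA: "finite A" using assms finite_subset by blast
  obtain \<phi> \<mu> where *: "eigenbasis (cfg d A) (marginal d V \<rho> A) \<phi> \<mu>" "\<And>j. j \<in> cfg d A \<Longrightarrow> \<mu> j > 0"
    using positive_definite_eigenbasis[OF finite_cfg[OF fA] marginal_ops marginal_positive_definite[OF assms]]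
    by blast
  then show ?thesis using that entropy_eigenbasis[OF fA *(1)] by blast
qed

text \<open>The space is one-dimensional, so the only eigenvalue is the trace of
  \<open>\<rho>\<close>, which is 1.\<close>

lemma entropy_empty:
  assumes "finite V" "\<rho> \<in> pos_states (cfg d V)"
  shows "entropy d V \<rho> {} = 0"
proof -
  obtain \<phi> \<mu> where eb: "eigenbasis (cfg d {}) (marginal d V \<rho> {}) \<phi> \<mu>"
    and e: "entropy d V \<rho> {} = - (\<Sum>j\<in>cfg d {}. \<mu> j * ln (\<mu> j))"
    using marginal_eigenbasis[OF assms, of "{}"] by blast
  have c: "cfg d {} = {\<lambda>_. undefined}" by (simp add: cfg_def)
  have "op_trace (cfg d {}) (marginal d V \<rho> {}) = op_trace (cfg d V) \<rho>"
    by (simp add: op_trace_def c marginal_def)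
  also have "\<dots> = 1" using assms(2) by (simp add: pos_states_def)
  finally have "\<mu> (\<lambda>_. undefined) = 1"
    using eigenbasis_trace[OF _ eb] by (simp add: c)
  then show ?thesis by (simp add: e c)
qed

text \<open>The inequality for product index sets is carried to configurations along the bijections
  \<open>gAB\<close>, \<open>gBC\<close> and \<open>gABC\<close>. The conditioning set is
  \<open>B\<close>.\<close>

lemma strong_subadditivity:
  fixes V A B C :: "'v set"
  assumes fV: "finite V" and \<rho>: "\<rho> \<in> pos_states (cfg d V)"
    and sub: "A \<subseteq> V" "B \<subseteq> V" "C \<subseteq> V" and disj: "A \<inter> B = {}" "A \<inter> C = {}" "B \<inter> C = {}"
  shows "cond_mutual_info d V \<rho> A C B \<ge> 0"
proof -
  have fin: "finite A" "finite B" "finite C" using sub fV finite_subset by blast+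
  have s: "A \<union> (B \<union> C) \<subseteq> V" "A \<union> B \<subseteq> V" "B \<union> C \<subseteq> V" using sub by auto
  define gAB gBC :: "('v \<Rightarrow> nat) \<times> ('v \<Rightarrow> nat) \<Rightarrow> 'v \<Rightarrow> nat" and gABC
    where "gAB = (\<lambda>(a, b). override_on b a A)"
      and "gBC = (\<lambda>(b, c). override_on c b B)"
      and "gABC = (\<lambda>(a, y). override_on (gBC y) a A)"
  have bAB: "bij_betw gAB (cfg d A \<times> cfg d B) (cfg d (A \<union> B))"
    unfolding gAB_def by (rule bij_betw_override_on[OF disj(1)])
  have bBC: "bij_betw gBC (cfg d B \<times> cfg d C) (cfg d (B \<union> C))"
    unfolding gBC_def by (rule bij_betw_override_on[OF disj(3)])
  have bABC: "bij_betw gABC (cfg d A \<times> (cfg d B \<times> cfg d C)) (cfg d (A \<union> (B \<union> C)))"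
  proof -
    have "bij_betw (map_prod id gBC) (cfg d A \<times> (cfg d B \<times> cfg d C)) (cfg d A \<times> cfg d (B \<union> C))"
      by (rule bij_betw_map_prod[OF bij_betw_id bBC])
    moreover have "bij_betw (\<lambda>(x, z). override_on z x A) (cfg d A \<times> cfg d (B \<union> C)) (cfg d (A \<union> (B \<union> C)))"
      using disj by (intro bij_betw_override_on) auto
    ultimately have "bij_betw ((\<lambda>(x, z). override_on z x A) \<circ> map_prod id gBC)
        (cfg d A \<times> (cfg d B \<times> cfg d C)) (cfg d (A \<union> (B \<union> C)))"
      by (rule bij_betw_trans)
    moreover have "(\<lambda>(x, z). override_on z x A) \<circ> map_prod id gBC = gABC"
      unfolding gABC_def by (rule ext) (simp add: case_prod_unfold)
    ultimately show ?thesis by simp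
  qed
  define R where "R = (\<lambda>x y. marginal d V \<rho> (A \<union> (B \<union> C)) (gABC x) (gABC y))"
  obtain \<phi> p where p: "eigenbasis (cfg d (A \<union> (B \<union> C))) (marginal d V \<rho> (A \<union> (B \<union> C))) \<phi> p"
    "\<And>j. j \<in> cfg d (A \<union> (B \<union> C)) \<Longrightarrow> p j > 0"
    "entropy d V \<rho> (A \<union> (B \<union> C)) = - (\<Sum>j\<in>cfg d (A \<union> (B \<union> C)). p j * ln (p j))"
    using marginal_eigenbasis[OF fV \<rho> s(1)] by blast
  obtain \<phi>' p' where p': "eigenbasis (cfg d (A \<union> B)) (marginal d V \<rho> (A \<union> B)) \<phi>' p'"
    "\<And>j. j \<in> cfg d (A \<union> B) \<Longrightarrow> p' j > 0"
    "entropy d V \<rho> (A \<union> B) = - (\<Sum>j\<in>cfg d (A \<union> B). p' j * ln (p' j))"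
    using marginal_eigenbasis[OF fV \<rho> s(2)] by blast
  obtain \<psi> q where q: "eigenbasis (cfg d (B \<union> C)) (marginal d V \<rho> (B \<union> C)) \<psi> q"
    "\<And>j. j \<in> cfg d (B \<union> C) \<Longrightarrow> q j > 0"
    "entropy d V \<rho> (B \<union> C) = - (\<Sum>j\<in>cfg d (B \<union> C). q j * ln (q j))"
    using marginal_eigenbasis[OF fV \<rho> s(3)] by blast
  obtain \<psi>' q' where q': "eigenbasis (cfg d B) (marginal d V \<rho> B) \<psi>' q'"
    "\<And>j. j \<in> cfg d B \<Longrightarrow> q' j > 0"
    "entropy d V \<rho> B = - (\<Sum>j\<in>cfg d B. q' j * ln (q' j))"
    using marginal_eigenbasis[OF fV \<rho> sub(2)] by blast
  \<comment> \<open>The next three facts recognize the partial traces of \<open>R\<close> as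
    marginals of \<open>\<rho>\<close>.\<close>
  have mAB: "(\<Sum>c\<in>cfg d C. R (a, b, c) (a', b', c)) = marginal d V \<rho> (A \<union> B) (gAB (a, b)) (gAB (a', b'))"
    if "a \<in> cfg d A" "b \<in> cfg d B" "a' \<in> cfg d A" "b' \<in> cfg d B" for a b a' b'
  proof -
    have "override_on c (gAB (a, b)) (A \<union> B) = gABC (a, b, c)" for a b c
      by (auto simp: gAB_def gABC_def gBC_def override_on_def)
    moreover have "gAB (a, b) \<in> cfg d (A \<union> B)" "gAB (a', b') \<in> cfg d (A \<union> B)"
      using that override_on_cfg by (auto simp: gAB_def)
    ultimately show ?thesis
      using marginal_split[of "A \<union> B" C V "gAB (a, b)" d "gAB (a', b')" \<rho>] disj s(1)
      unfolding R_def Un_assoc by (simp add: Int_Un_distrib2)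
  qed
  have mBC: "(\<Sum>a\<in>cfg d A. R (a, y) (a, z)) = marginal d V \<rho> (B \<union> C) (gBC y) (gBC z)"
    if "y \<in> cfg d B \<times> cfg d C" "z \<in> cfg d B \<times> cfg d C" for y z
  proof -
    have yz: "gBC y \<in> cfg d (B \<union> C)" "gBC z \<in> cfg d (B \<union> C)"
      using that bBC bij_betwE by blast+
    \<comment> \<open>\<open>marginal_split\<close> overrides on the kept set
      \<open>B \<union> C\<close>, while \<open>gABC\<close> overrides on \<open>A\<close>; on
      disjoint domains both give the same configuration.\<close>
    have o: "override_on a x (B \<union> C) = override_on x a A" if "a \<in> cfg d A" "x \<in> cfg d (B \<union> C)" for a x
      using that disj by (fastforce simp: cfg_def override_on_def PiE_def extensional_def fun_eq_iff)
    have e: "B \<union> C \<union> A = A \<union> (B \<union> C)" "(B \<union> C) \<inter> A = {}" using disj by auto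
    have "marginal d V \<rho> (B \<union> C) (gBC y) (gBC z)
      = (\<Sum>a\<in>cfg d A. marginal d V \<rho> (A \<union> (B \<union> C))
          (override_on a (gBC y) (B \<union> C)) (override_on a (gBC z) (B \<union> C)))"
      by (rule marginal_split[OF e(2) _ yz, unfolded e(1), OF s(1)])
    also have "\<dots> = (\<Sum>a\<in>cfg d A. R (a, y) (a, z))"
      using yz by (intro sum.cong refl) (simp add: o R_def gABC_def)
    finally show ?thesis by simp
  qed
  have mB: "(\<Sum>a\<in>cfg d A. \<Sum>c\<in>cfg d C. R (a, b, c) (a, b', c)) = marginal d V \<rho> B b b'"
    if "b \<in> cfg d B" "b' \<in> cfg d B" for b b'
  proof -
    have "(\<Sum>a\<in>cfg d A. \<Sum>c\<in>cfg d C. R (a, b, c) (a, b', c))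
      = (\<Sum>c\<in>cfg d C. marginal d V \<rho> (B \<union> C) (gBC (b, c)) (gBC (b', c)))"
      using that by (subst sum.swap) (simp add: mBC)
    then show ?thesis
      using marginal_split[OF disj(3) s(3) that] by (simp add: gBC_def)
  qed
  have "(\<Sum>j\<in>cfg d A \<times> cfg d B. p' (gAB j) * ln (p' (gAB j))) - (\<Sum>k\<in>cfg d B. q' k * ln (q' k))
    \<le> (\<Sum>j\<in>cfg d A \<times> (cfg d B \<times> cfg d C). p (gABC j) * ln (p (gABC j)))
      - (\<Sum>k\<in>cfg d B \<times> cfg d C. q (gBC k) * ln (q (gBC k)))"
  proof (rule strong_subadditivity_product)
    show "eigenbasis (cfg d A \<times> (cfg d B \<times> cfg d C)) R (\<lambda>j y. \<phi> (gABC j) (gABC y)) (\<lambda>j. p (gABC j))"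
      unfolding R_def by (rule eigenbasis_reindex[OF p(1) bABC])
    show "eigenbasis (cfg d A \<times> cfg d B) (\<lambda>(a, b) (a', b'). \<Sum>c\<in>cfg d C. R (a, b, c) (a', b', c))
       (\<lambda>j y. \<phi>' (gAB j) (gAB y)) (\<lambda>j. p' (gAB j))"
      by (rule eigenbasis_cong[OF eigenbasis_reindex[OF p'(1) bAB]]) (auto simp: mAB)
    show "eigenbasis (cfg d B \<times> cfg d C) (\<lambda>y z. \<Sum>a\<in>cfg d A. R (a, y) (a, z))
       (\<lambda>j y. \<psi> (gBC j) (gBC y)) (\<lambda>j. q (gBC j))"
      by (rule eigenbasis_cong[OF eigenbasis_reindex[OF q(1) bBC]]) (rule mBC)
    show "eigenbasis (cfg d B) (\<lambda>b b'. \<Sum>a\<in>cfg d A. \<Sum>c\<in>cfg d C. R (a, b, c) (a, b', c)) \<psi>' q'"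
      by (rule eigenbasis_cong[OF q'(1)]) (rule mB)
    show "p (gABC j) > 0" if "j \<in> cfg d A \<times> (cfg d B \<times> cfg d C)" for j
      using p(2) bij_betwE[OF bABC] that by blast
    show "p' (gAB j) > 0" if "j \<in> cfg d A \<times> cfg d B" for j
      using p'(2) bij_betwE[OF bAB] that by blast
    show "q (gBC j) > 0" if "j \<in> cfg d B \<times> cfg d C" for j
      using q(2) bij_betwE[OF bBC] that by blast
    show "q' j > 0" if "j \<in> cfg d B" for j using q'(2) that .
  qed (use fin finite_cfg in auto)
  also have "(\<Sum>j\<in>cfg d A \<times> cfg d B. p' (gAB j) * ln (p' (gAB j))) = - entropy d V \<rho> (A \<union> B)"
    unfolding p'(3) using sum.reindex_bij_betw[OF bAB] by simp
  also have "(\<Sum>j\<in>cfg d A \<times> (cfg d B \<times> cfg d C). p (gABC j) * ln (p (gABC j))) = - entropy d V \<rho> (A \<union> (B \<union> C))"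
    unfolding p(3) using sum.reindex_bij_betw[OF bABC] by simp
  also have "(\<Sum>k\<in>cfg d B \<times> cfg d C. q (gBC k) * ln (q (gBC k))) = - entropy d V \<rho> (B \<union> C)"
    unfolding q(3) using sum.reindex_bij_betw[OF bBC] by simp
  also have "(\<Sum>k\<in>cfg d B. q' k * ln (q' k)) = - entropy d V \<rho> B"
    unfolding q'(3) by simp
  finally show ?thesis
    by (simp add: cond_mutual_info_def Un_ac)
qed

section \<open>Submodular functions and walks in a directed acyclic graph\<close>

text \<open>Defined for any set function, so that the graph-theoretic part depends on the entropy
  only through submodularity.\<close>

definition cmi :: "('v set \<Rightarrow> real) \<Rightarrow> 'v set \<Rightarrow> 'v set \<Rightarrow> 'v set \<Rightarrow> real" where
  "cmi h A B C = h (A \<union> C) + h (B \<union> C) - h C - h (A \<union> B \<union> C)"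

lemma cmi_sym: "cmi h A B C = cmi h B A C"
  by (simp add: cmi_def Un_ac)

text \<open>The terms at \<open>B \<union> C\<close> and at \<open>A \<union> B \<union> C\<close>
  cancel.\<close>

lemma cmi_chain: "cmi h A (B \<union> D) C = cmi h A B C + cmi h A D (B \<union> C)"
  by (simp add: cmi_def Un_ac)

definition submodular_on :: "'v set \<Rightarrow> ('v set \<Rightarrow> real) \<Rightarrow> bool" where
  "submodular_on V h \<longleftrightarrow> (\<forall>A B C. A \<subseteq> V \<and> B \<subseteq> V \<and> C \<subseteq> V \<and> A \<inter> B = {} \<and> A \<inter> C = {} \<and> B \<inter> C = {}
     \<longrightarrow> cmi h A B C \<ge> 0)"

text \<open>The chain rule writes the left side as a sum of two nonnegative terms. Read forwards
  this is decomposition and weak union, read backwards contraction.\<close>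

lemma cmi_chain_eq_0:
  assumes h: "submodular_on V h" and sub: "A \<subseteq> V" "B \<subseteq> V" "C \<subseteq> V"
    and disj: "A \<inter> B = {}" "A \<inter> C = {}" "B \<inter> C = {}" and D: "D \<subseteq> B"
  shows "cmi h A B C = 0 \<longleftrightarrow> cmi h A D C = 0 \<and> cmi h A (B - D) (D \<union> C) = 0"
proof -
  have "B = D \<union> (B - D)" using D by auto
  then have "cmi h A B C = cmi h A D C + cmi h A (B - D) (D \<union> C)" using cmi_chain by metis
  moreover have "cmi h A D C \<ge> 0" "cmi h A (B - D) (D \<union> C) \<ge> 0"
  proof -
    have "D \<subseteq> V" "A \<inter> D = {}" "D \<inter> C = {}" using sub disj D by auto
    then show "cmi h A D C \<ge> 0" using h sub disj unfolding submodular_on_def by blast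
    have "B - D \<subseteq> V" "D \<union> C \<subseteq> V" "A \<inter> (B - D) = {}" "A \<inter> (D \<union> C) = {}" "(B - D) \<inter> (D \<union> C) = {}"
      using sub disj D by auto
    then show "cmi h A (B - D) (D \<union> C) \<ge> 0" using h sub unfolding submodular_on_def by blast
  qed
  ultimately show ?thesis by linarith
qed

section \<open>Topological orderings and the chain rule\<close>

lemma topological_ordering_trans: "topological_ordering V E r \<Longrightarrow> trans r"
  and topological_ordering_irrefl: "topological_ordering V E r \<Longrightarrow> (v, v) \<notin> r"
  and topological_ordering_total:
    "topological_ordering V E r \<Longrightarrow> u \<in> V \<Longrightarrow> v \<in> V \<Longrightarrow> u \<noteq> v \<Longrightarrow> (u, v) \<in> r \<or> (v, u) \<in> r"
  and topological_ordering_arrows: "topological_ordering V E r \<Longrightarrow> E \<subseteq> r"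
  and topological_ordering_field: "topological_ordering V E r \<Longrightarrow> r \<subseteq> V \<times> V"
  by (auto simp: topological_ordering_def strict_linear_order_on_def irrefl_def total_on_def)

lemma pa_subset_pr: "topological_ordering V E r \<Longrightarrow> pa E v \<subseteq> pr r v"
  using topological_ordering_arrows by (auto simp: pa_def pr_def)

lemma pr_subset: "topological_ordering V E r \<Longrightarrow> pr r v \<subseteq> V"
  using topological_ordering_field by (fastforce simp: pr_def)

text \<open>Builds \<open>V\<close> along the ordering: \<open>pr r v = U\<close> says that
  \<open>v\<close> is added right after exactly the vertices of \<open>U\<close>.\<close>

lemma topological_induct [consumes 2, case_names empty insert]:
  assumes fV: "finite V" and r: "topological_ordering V E r"
    and empty: "P {}"
    and insert: "\<And>v U. v \<in> V \<Longrightarrow> U \<subseteq> V \<Longrightarrow> v \<notin> U \<Longrightarrow> pr r v = U \<Longrightarrow> P U \<Longrightarrow> P (insert v U)"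
  shows "P V"
proof -
  \<comment> \<open>Generalized to initial segments of the ordering, which stay initial segments
    when their greatest vertex is removed.\<close>
  have "P U" if "U \<subseteq> V" "\<And>v. v \<in> U \<Longrightarrow> pr r v \<subseteq> U" for U
    using that
  proof (induction "card U" arbitrary: U)
    case 0
    then show ?case using empty finite_subset[OF _ fV] by auto
  next
    case (Suc n)
    have "finite r" using topological_ordering_field[OF r] fV finite_subset by blast
    moreover have "acyclic r"
      using topological_ordering_trans[OF r] topological_ordering_irrefl[OF r]
      by (simp add: acyclic_irrefl trancl_id irrefl_def)
    ultimately have wf: "wf (r\<inverse>)" by (rule finite_acyclic_wf_converse)
    obtain x where "x \<in> U" using Suc(2) by fastforce
    then obtain v where v: "v \<in> U" and max: "\<And>y. (v, y) \<in> r \<Longrightarrow> y \<notin> U"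
      using wfE_min[OF wf] by (metis converse_iff)
    have prv: "pr r v = U - {v}"
    proof
      show "pr r v \<subseteq> U - {v}"
        using Suc(4)[OF v] topological_ordering_irrefl[OF r, of v] by (auto simp: pr_def)
      show "U - {v} \<subseteq> pr r v"
        using max topological_ordering_total[OF r] v Suc(3) unfolding pr_def by blast
    qed
    have "P (U - {v})"
    proof (rule Suc(1))
      show "n = card (U - {v})" using Suc(2) v by simp
      show "U - {v} \<subseteq> V" using Suc(3) by auto
      show "pr r w \<subseteq> U - {v}" if "w \<in> U - {v}" for w
        using Suc(4)[of w] max[of w] that by (auto simp: pr_def)
    qed
    then have "P (insert v (U - {v}))"
      using v Suc(3) prv by (intro insert) auto
    then show ?case using v by (simp add: insert_absorb)
  qed
  then show ?thesis using pr_subset[OF r] by blast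
qed

text \<open>The sum telescopes, because \<open>pr r v\<close> is the set of vertices added before
  \<open>v\<close>.\<close>

lemma sum_chain_rule:
  assumes "finite V" "topological_ordering V E r" "h {} = (0::real)"
  shows "(\<Sum>v\<in>V. h ({v} \<union> pr r v) - h (pr r v)) = h V"
  using assms(1,2)
proof (induction rule: topological_induct)
  case empty
  then show ?case using assms by simp
next
  case (insert v U)
  then show ?case using finite_subset[OF insert(2) assms(1)] by simp
qed

text \<open>Each \<open>cmi\<close> on the right is the increment of \<open>h\<close> by
  \<open>v\<close> over its parents minus that over all its predecessors; the latter increments sum
  to \<open>h V\<close>.\<close>

lemma excess_eq_sum_cmi:
  assumes "finite V" "topological_ordering V E r" "h {} = (0::real)"
  shows "(\<Sum>v\<in>V. h ({v} \<union> pa E v) - h (pa E v)) - h V = (\<Sum>v\<in>V. cmi h {v} (pr r v - pa E v) (pa E v))"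
proof -
  have "pr r v - pa E v \<union> pa E v = pr r v" for v
    using pa_subset_pr[OF assms(2)] by blast
  then have "cmi h {v} (pr r v - pa E v) (pa E v)
    = (h ({v} \<union> pa E v) - h (pa E v)) - (h ({v} \<union> pr r v) - h (pr r v))" for v
    by (simp add: cmi_def Un_assoc)
  then show ?thesis using sum_chain_rule[of V E r h] assms by (simp add: sum_subtractf)
qed

text \<open>Vertices are sorted by their number of ancestors, with ties broken by an injection into
  the naturals.\<close>

lemma ex_topological_ordering:
  assumes "is_dag V E"
  obtains r where "topological_ordering V E r"
proof -
  have fV: "finite V" and EV: "E \<subseteq> V \<times> V" and ac: "acyclic E" using assms by (auto simp: is_dag_def)
  obtain g :: "'a \<Rightarrow> nat" where g: "inj_on g V" using fV finite_imp_inj_to_nat_seg by blast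
  define c where "c = (\<lambda>v. card {u. (u, v) \<in> E\<^sup>+})"
  have EV': "E\<^sup>+ \<subseteq> V \<times> V" using EV trancl_subset_Sigma by blast
  have c: "c u < c v" if "(u, v) \<in> E" for u v
    unfolding c_def
  proof (rule psubset_card_mono)
    show "finite {u. (u, v) \<in> E\<^sup>+}"
      by (rule finite_subset[OF _ fV]) (use EV' in auto)
    \<comment> \<open>Strict because \<open>u\<close> is an ancestor of \<open>v\<close> but, by
      acyclicity, not of itself.\<close>
    show "{w. (w, u) \<in> E\<^sup>+} \<subset> {u. (u, v) \<in> E\<^sup>+}"
      using that ac by (auto simp: acyclic_def intro: trancl_into_trancl)
  qed
  define r where "r = {(u, v). u \<in> V \<and> v \<in> V \<and> (c u < c v \<or> c u = c v \<and> g u < g v)}"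
  have "trans r" by (rule transI) (auto simp: r_def)
  moreover have "irrefl r" by (auto simp: irrefl_def r_def)
  moreover have "total_on V r"
    using g by (auto simp: total_on_def r_def inj_on_def) (metis linorder_neqE_nat)
  moreover have "E \<subseteq> r" using c EV by (auto simp: r_def)
  ultimately have "topological_ordering V E r"
    by (auto simp: topological_ordering_def strict_linear_order_on_def r_def)
  then show ?thesis by (rule that)
qed

section \<open>Reversing, extending and joining active walks\<close>

lemma collider_at_append:
  "i + 1 < length p \<Longrightarrow> collider_at F (p @ q) i \<longleftrightarrow> collider_at F p i"
  by (auto simp: collider_at_def nth_append)

lemma collider_at_rev:
  assumes "i < length p"
  shows "collider_at F (rev p) i \<longleftrightarrow> collider_at F p (length p - Suc i)"
proof (cases "0 < i \<and> i + 1 < length p")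
  case True
  then have "length p - Suc (i - 1) = length p - Suc i + 1" "length p - Suc (i + 1) = length p - Suc i - 1"
    by auto
  then show ?thesis using True by (auto simp: collider_at_def rev_nth)
qed (use assms in \<open>auto simp: collider_at_def\<close>)

lemma active_walk_rev: "active_walk F S (rev p) \<longleftrightarrow> active_walk F S p"
proof -
  have "active_walk F S (rev p)" if "active_walk F S p" for p
    using that unfolding active_walk_def by (auto simp: collider_at_rev rev_nth split: if_splits)
  then show ?thesis by (metis rev_rev_ident)
qed

lemma is_walk_rev: "is_walk F (rev p) \<longleftrightarrow> is_walk F p"
  by (simp add: is_walk_def disj_commute)

lemma is_walk_append:
  "p \<noteq> [] \<Longrightarrow> q \<noteq> [] \<Longrightarrow> is_walk F (p @ q) \<longleftrightarrow>
    is_walk F p \<and> is_walk F q \<and> ((last p, hd q) \<in> F \<or> (hd q, last p) \<in> F)"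
  by (auto simp: is_walk_def successively_append_iff)

lemma d_separated_sym:
  assumes "d_separated F A B S"
  shows "d_separated F B A S"
  unfolding d_separated_def
proof (intro allI impI notI, elim conjE)
  fix p assume p: "is_walk F p" "hd p \<in> B" "last p \<in> A" "active_walk F S p"
  then have "p \<noteq> []" by (simp add: is_walk_def)
  then show False using p assms is_walk_rev[of F p] active_walk_rev[of F S p]
    unfolding d_separated_def by (metis hd_rev last_rev)
qed

text \<open>Leaving the last vertex along an outgoing arrow keeps it a non-collider, so no old
  position changes its status; the new endpoint is outside \<open>S\<close>.\<close>

lemma active_walk_snoc:
  assumes p: "is_walk F p" "active_walk F S p" and v: "(last p, v) \<in> F" "(v, last p) \<notin> F" "v \<notin> S"
  shows "is_walk F (p @ [v])" "active_walk F S (p @ [v])"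
proof -
  have ne: "p \<noteq> []" using p by (simp add: is_walk_def)
  then show "is_walk F (p @ [v])" using p v by (simp add: is_walk_append) (simp add: is_walk_def)
  have "collider_at F (p @ [v]) i \<longleftrightarrow> collider_at F p i" if "i < length p" for i
  proof (cases "i + 1 < length p")
    case True
    then show ?thesis by (rule collider_at_append)
  next
    case False
    then have i: "i = length p - 1" using that by linarith
    then have "p ! i = last p" using ne by (simp add: last_conv_nth)
    then show ?thesis using v ne i by (auto simp: collider_at_def nth_append)
  qed
  moreover have "\<not> collider_at F (p @ [v]) (length p)" by (simp add: collider_at_def)
  ultimately show "active_walk F S (p @ [v])"
    using p v by (auto simp: active_walk_def nth_append less_Suc_eq)
qed

text \<open>Both walks enter \<open>v\<close> by an arrow, which makes \<open>v\<close> a collider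
  at the junction. Elsewhere \<open>v\<close> does not occur, so adding it to \<open>S\<close>
  changes nothing there.\<close>

lemma active_walk_join:
  assumes p: "is_walk F (p @ [v])" "active_walk F S (p @ [v])" "(last p, v) \<in> F" "p \<noteq> []" "v \<notin> set p"
    and q: "is_walk F (q @ [v])" "active_walk F S (q @ [v])" "(last q, v) \<in> F" "q \<noteq> []" "v \<notin> set q"
  shows "is_walk F (p @ v # rev q)" "active_walk F (insert v S) (p @ v # rev q)"
proof -
  have "is_walk F (rev (q @ [v]))" using q(1) by (simp only: is_walk_rev)
  then have "is_walk F (v # rev q)" by simp
  moreover have "is_walk F p" using p by (simp add: is_walk_append)
  ultimately show "is_walk F (p @ v # rev q)" using p by (simp add: is_walk_append)
  \<comment> \<open>Stated for arbitrary \<open>p\<close> and \<open>q\<close>: the second half of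
    the walk is treated as the first half of the reversed walk.\<close>
  have *: "if collider_at F (p @ v # rev q) i then (p @ v # rev q) ! i \<in> insert v S
      else (p @ v # rev q) ! i \<notin> insert v S"
    if "active_walk F S (p @ [v])" "v \<notin> set p" "i < length p" for p q i
  proof -
    have "collider_at F (p @ v # rev q) i \<longleftrightarrow> collider_at F (p @ [v]) i"
      using collider_at_append[of i "p @ [v]" F "rev q"] that by simp
    moreover have "p ! i \<noteq> v" using that by auto
    ultimately show ?thesis using that unfolding active_walk_def
      by (auto simp: nth_append less_Suc_eq split: if_splits)
  qed
  show "active_walk F (insert v S) (p @ v # rev q)"
    unfolding active_walk_def
  proof (intro allI impI)
    let ?w = "p @ v # rev q"
    fix i assume i: "i < length ?w"
    consider "i < length p" | "i = length p" | "i > length p" by linarith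
    then show "if collider_at F ?w i then ?w ! i \<in> insert v S else ?w ! i \<notin> insert v S"
    proof cases
      case 1
      then show ?thesis using * p by blast
    next
      case 2
      have "?w ! (i - 1) = last p" using 2 p by (simp add: nth_append last_conv_nth)
      moreover have "?w ! (i + 1) = last q" using 2 q by (simp add: nth_append rev_nth last_conv_nth)
      ultimately have "collider_at F ?w i" using 2 p q by (auto simp: collider_at_def)
      then show ?thesis using 2 by simp
    next
      case 3
      let ?j = "length ?w - Suc i"
      have j: "?j < length q" "length ?w - Suc ?j = i" using 3 i by auto
      have "rev ?w = q @ v # rev p" by simp
      then have "collider_at F ?w i \<longleftrightarrow> collider_at F (q @ v # rev p) ?j" "?w ! i = (q @ v # rev p) ! ?j"
        using collider_at_rev[of ?j ?w F] rev_nth[of ?j ?w] j i by auto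
      then show ?thesis using *[OF q(2,5) j(1), of p] by metis
    qed
  qed
qed

text \<open>Both edges at an inner visit to a sink must point into it.\<close>

lemma collider_at_sink:
  assumes "is_walk F p" "\<And>w. (v, w) \<notin> F" "p ! i = v" "0 < i" "i + 1 < length p"
  shows "collider_at F p i"
proof -
  have s: "(p ! j, p ! Suc j) \<in> F \<or> (p ! Suc j, p ! j) \<in> F" if "Suc j < length p" for j
    using assms(1) that unfolding is_walk_def successively_conv_nth by blast
  show ?thesis using s[of "i - 1"] s[of i] assms by (simp add: collider_at_def)
qed

lemma walk_in_subgraph:
  assumes "is_walk (E \<inter> U \<times> U) p" "hd p \<in> U"
  shows "set p \<subseteq> U"
  using assms by (induction p rule: induct_list012) (auto simp: is_walk_def)

text \<open>The walk stays in \<open>U\<close>, where both induced subgraphs have the same arrows,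
  so its colliders are the same.\<close>

lemma active_walk_supergraph:
  assumes p: "is_walk (E \<inter> U \<times> U) p" "hd p \<in> U" "active_walk (E \<inter> U \<times> U) S p" and U: "U \<subseteq> W"
  shows "is_walk (E \<inter> W \<times> W) p" "active_walk (E \<inter> W \<times> W) S p"
proof -
  have sp: "set p \<subseteq> U" by (rule walk_in_subgraph[OF p(1,2)])
  show "is_walk (E \<inter> W \<times> W) p"
    using p(1) U unfolding is_walk_def successively_conv_nth by auto
  have nU: "p ! i \<in> U" if "i < length p" for i using sp that by auto
  have "collider_at (E \<inter> W \<times> W) p i \<longleftrightarrow> collider_at (E \<inter> U \<times> U) p i" for i
    using nU[of i] nU[of "i - 1"] nU[of "i + 1"] U by (auto simp: collider_at_def)
  then show "active_walk (E \<inter> W \<times> W) S p" using p(3) by (simp add: active_walk_def)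
qed


lemma d_separated_subgraph:
  assumes "d_separated (E \<inter> W \<times> W) A B S" "U \<subseteq> W" "A \<subseteq> U"
  shows "d_separated (E \<inter> U \<times> U) A B S"
  using assms active_walk_supergraph[OF _ _ _ assms(2)] unfolding d_separated_def by blast

text \<open>
  Otherwise there are active walks from \<open>A\<close> and from \<open>B\<close> to the sink \<open>v\<close>, and joining them makes \<open>v\<close> a
  collider of an active walk relative to \<open>insert v S\<close>.
\<close>
lemma d_separated_remove_collider:
  assumes sink: "\<And>w. (v, w) \<notin> F" and sep: "d_separated F A B (insert v S)"
    and v: "v \<notin> A" "v \<notin> B" "v \<notin> S"
  shows "d_separated F A (insert v B) S \<or> d_separated F B (insert v A) S"
proof -
  \<comment> \<open>An active walk not starting at \<open>v\<close> can visit \<open>v\<close> only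
    at its end: an inner visit to the sink would be a collider outside \<open>S\<close>.\<close>
  have tail: "v \<notin> set p" if p: "is_walk F (p @ [w])" "hd (p @ [w]) \<noteq> v" "active_walk F S (p @ [w])" for p w
  proof
    assume "v \<in> set p"
    then obtain i where i: "i < length p" "p ! i = v" by (auto simp: in_set_conv_nth)
    then have "i > 0" using p(2) by (cases p) (auto intro: gr0I)
    then have "collider_at F (p @ [w]) i"
      using collider_at_sink[OF p(1) sink, of i] i by (auto simp: nth_append)
    moreover have "i < length (p @ [w])" "(p @ [w]) ! i = v" using i by (auto simp: nth_append)
    ultimately show False using p(3) v(3) unfolding active_walk_def by metis
  qed
  \<comment> \<open>Such a walk would miss \<open>v\<close> altogether and so remain active relative
    to \<open>insert v S\<close>.\<close>
  have avoid: False if p: "is_walk F p" "hd p \<in> A" "last p \<in> B" "active_walk F S p" for p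
  proof -
    obtain q w where q: "p = q @ [w]" using p(1) by (cases p rule: rev_cases) (auto simp: is_walk_def)
    have "hd (q @ [w]) \<noteq> v" "w \<noteq> v" using p(2,3) v q by auto
    then have "v \<notin> set p" using tail[OF p(1)[unfolded q] _ p(4)[unfolded q]] q by auto
    then have "active_walk F (insert v S) p" using p(4) unfolding active_walk_def
      by (metis insert_iff nth_mem)
    then show False using sep p unfolding d_separated_def by blast
  qed
  have to_v: "\<exists>q. is_walk F (q @ [v]) \<and> active_walk F S (q @ [v]) \<and> (last q, v) \<in> F \<and> q \<noteq> []
      \<and> v \<notin> set q \<and> hd q \<in> C"
    if p: "is_walk F p" "hd p \<in> C" "last p = v" "active_walk F S p" and C: "v \<notin> C" for p C
  proof -
    obtain q where q: "p = q @ [v]" using p by (cases p rule: rev_cases) (auto simp: is_walk_def)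
    have ne: "q \<noteq> []" using q p C by auto
    have "hd (q @ [v]) \<noteq> v" using p(2) C q by metis
    then have "v \<notin> set q" using tail[OF p(1)[unfolded q] _ p(4)[unfolded q]] by blast
    moreover have "(last q, v) \<in> F" using p(1) q ne sink by (auto simp: is_walk_append)
    ultimately show ?thesis using p q ne by auto
  qed
  show ?thesis
  proof (rule ccontr)
    assume neg: "\<not> ?thesis"
    then obtain p where p: "is_walk F p" "hd p \<in> A" "last p \<in> insert v B" "active_walk F S p"
      unfolding d_separated_def by blast
    from neg obtain q where q: "is_walk F q" "hd q \<in> B" "last q \<in> insert v A" "active_walk F S q"
      unfolding d_separated_def by blast
    have "last p = v" using avoid p by blast
    moreover have "last q = v"
    proof (rule ccontr)
      assume "last q \<noteq> v"
      moreover have "q \<noteq> []" using q by (simp add: is_walk_def)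
      ultimately show False using avoid[of "rev q"] q by (simp add: is_walk_rev active_walk_rev hd_rev last_rev)
    qed
    ultimately obtain p' q' where
      p': "is_walk F (p' @ [v])" "active_walk F S (p' @ [v])" "(last p', v) \<in> F" "p' \<noteq> []" "v \<notin> set p'" "hd p' \<in> A"
      and q': "is_walk F (q' @ [v])" "active_walk F S (q' @ [v])" "(last q', v) \<in> F" "q' \<noteq> []" "v \<notin> set q'" "hd q' \<in> B"
      using to_v[OF p(1,2) _ p(4) v(1)] to_v[OF q(1,2) _ q(4) v(2)] by metis
    have "hd (p' @ v # rev q') \<in> A" "last (p' @ v # rev q') \<in> B"
      using p' q' by (simp_all add: last_rev)
    then show False using sep active_walk_join[OF p'(1-5) q'(1-5)] unfolding d_separated_def by blast
  qed
qed

section \<open>From the ordered to the global property\<close>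

text \<open>Induction over initial segments, with d-separation taken in the induced subgraph. The
  vertex \<open>v\<close> added last is a sink there, and the cases depend on whether it lies in an
  endpoint set, in \<open>S\<close>, or in none of them.\<close>

lemma ordered_imp_global:
  assumes h: "submodular_on V h" and fV: "finite V" and r: "topological_ordering V E r"
    and O: "\<And>v. v \<in> V \<Longrightarrow> cmi h {v} (pr r v - pa E v) (pa E v) = 0"
  shows "\<forall>A B S. A \<subseteq> V \<and> B \<subseteq> V \<and> S \<subseteq> V \<and> A \<inter> B = {} \<and> A \<inter> S = {} \<and> B \<inter> S = {} \<and>
    d_separated (E \<inter> V \<times> V) A B S \<longrightarrow> cmi h A B S = 0"
  using fV r
proof (induction rule: topological_induct)
  case empty
  then show ?case by (auto simp: cmi_def)
next
  case (insert v U)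
  let ?F = "E \<inter> insert v U \<times> insert v U" and ?P = "pa E v"
  have IH: "cmi h A B S = 0" if "A \<subseteq> U" "B \<subseteq> U" "S \<subseteq> U" "A \<inter> B = {}" "A \<inter> S = {}" "B \<inter> S = {}"
    "d_separated (E \<inter> U \<times> U) A B S" for A B S
    using insert.IH that by blast
  have sink: "(v, w) \<notin> ?F" for w
  proof
    assume "(v, w) \<in> ?F"
    then have "(v, w) \<in> r" "w = v \<or> (w, v) \<in> r"
      using topological_ordering_arrows[OF r] insert(4) by (auto simp: pr_def)
    then show False
      using topological_ordering_irrefl[OF r] topological_ordering_trans[OF r] by (metis transD)
  qed
  have PU: "?P \<subseteq> U" using pa_subset_pr[OF r] insert(4) by metis
  have PF: "(u, v) \<in> ?F" if "u \<in> ?P" for u using that PU by (auto simp: pa_def)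
  have vV: "insert v U \<subseteq> V" using insert by auto
  have endpoint: "cmi h A B S = 0"
    if sub: "A \<subseteq> insert v U" "B \<subseteq> insert v U" "S \<subseteq> insert v U"
      and disj: "A \<inter> B = {}" "A \<inter> S = {}" "B \<inter> S = {}"
      and sep: "d_separated ?F A B S" and vB: "v \<in> B" for A B S
  proof -
    have AU: "A \<subseteq> U" and SU: "S \<subseteq> U" using sub disj vB by auto
    have vS: "v \<notin> S" and vU: "v \<notin> U" using disj vB insert by auto
    \<comment> \<open>In \<open>B\<close> the vertex \<open>v\<close> is traded for its parents
      outside \<open>S\<close>. Separation survives, since an active walk to such a parent extends
      along the arrow to \<open>v\<close>.\<close>
    define B' where "B' = (B - {v}) \<union> (?P - S)"
    have extend: False if p: "is_walk (E \<inter> U \<times> U) p" "hd p \<in> A" "last p \<in> B'" "active_walk (E \<inter> U \<times> U) S p" for p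
    proof -
      have w: "is_walk ?F p" "active_walk ?F S p"
        using active_walk_supergraph[OF p(1) _ p(4)] p(2) AU by blast+
      show False
      proof (cases "last p \<in> B")
        case True
        then show False using w p(2) sep unfolding d_separated_def by blast
      next
        case False
        then have "(last p, v) \<in> ?F" using p(3) PF by (auto simp: B'_def)
        then have "is_walk ?F (p @ [v])" "active_walk ?F S (p @ [v])"
          using active_walk_snoc[OF w] sink vS by blast+
        moreover have "hd (p @ [v]) \<in> A" using p by (simp add: is_walk_def)
        ultimately show False using sep vB unfolding d_separated_def by (metis last_snoc)
      qed
    qed
    \<comment> \<open>A common vertex would be an active walk of length one, which
      \<open>extend\<close> excludes.\<close>
    have AB': "A \<inter> B' = {}"
    proof (rule ccontr)
      assume "A \<inter> B' \<noteq> {}"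
      then obtain a where a: "a \<in> A" "a \<in> B'" by blast
      have "is_walk (E \<inter> U \<times> U) [a]" by (simp add: is_walk_def)
      moreover have "active_walk (E \<inter> U \<times> U) S [a]"
        using a disj by (auto simp: active_walk_def collider_at_def)
      ultimately show False using extend[of "[a]"] a by simp
    qed
    have AP: "A \<inter> ?P = {}" using AB' disj by (auto simp: B'_def)
    have B'U: "B' \<subseteq> U" using sub PU vB by (auto simp: B'_def)
    have B'S: "B' \<inter> S = {}" using disj by (auto simp: B'_def)
    have 1: "cmi h A B' S = 0"
      using extend by (intro IH AU B'U SU AB' disj(2) B'S) (auto simp: d_separated_def)
    have "cmi h {v} (U - ?P) ?P = 0" using O[OF insert(1)] insert(4) by simp
    \<comment> \<open>What remains of \<open>U\<close> after weak union has moved the part of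
      \<open>B' \<union> S\<close> outside the parents into the conditioning set. It still contains
      \<open>A\<close>.\<close>
    define D where "D = U - ?P - (B' \<union> S - ?P)"
    have "cmi h {v} D ((B' \<union> S - ?P) \<union> ?P) = 0"
      unfolding D_def
      using cmi_chain_eq_0[OF h, of "{v}" "U - ?P" ?P "B' \<union> S - ?P"] \<open>cmi h {v} (U - ?P) ?P = 0\<close>
        insert(1,2) PU B'U SU vU by blast
    moreover have "(B' \<union> S - ?P) \<union> ?P = B' \<union> S" by (auto simp: B'_def)
    ultimately have D0: "cmi h {v} D (B' \<union> S) = 0" by simp
    have "A \<subseteq> D" "D \<subseteq> V" "v \<notin> D" "v \<notin> B' \<union> S" "B' \<union> S \<subseteq> V" "D \<inter> (B' \<union> S) = {}"
      using AU AP AB' disj(2) insert(2) vU B'U SU by (auto simp: D_def)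
    then have 2: "cmi h A {v} (B' \<union> S) = 0"
      using cmi_chain_eq_0[OF h, of "{v}" D "B' \<union> S" A] D0 insert(1) by (simp add: cmi_sym[of h A])
    \<comment> \<open>Contraction adds \<open>v\<close> to \<open>B'\<close>; decomposition then
      cuts the result down to \<open>B\<close>.\<close>
    have 3: "cmi h A (insert v B') S = 0"
      using 1 2 cmi_chain[of h A B' "{v}" S] by simp
    have "B \<subseteq> insert v B'" by (auto simp: B'_def)
    then show ?thesis
      using 3 cmi_chain_eq_0[OF h, of A "insert v B'" S B] AB' B'S disj sub vV B'U vB by blast
  qed
  show ?case
  proof (intro allI impI, elim conjE)
    fix A B S
    assume sub: "A \<subseteq> insert v U" "B \<subseteq> insert v U" "S \<subseteq> insert v U"
      and disj: "A \<inter> B = {}" "A \<inter> S = {}" "B \<inter> S = {}" and sep: "d_separated ?F A B S"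
    consider "v \<in> B" | "v \<in> A" | "v \<in> S" | "v \<notin> A \<union> B \<union> S" by blast
    then show "cmi h A B S = 0"
    proof cases
      case 1
      then show ?thesis using endpoint sub disj sep by blast
    next
      case 2
      then have "cmi h B A S = 0"
        using endpoint[of B A S] sub disj d_separated_sym[OF sep] by blast
      then show ?thesis by (simp add: cmi_sym)
    next
      case 4
      then have "A \<subseteq> U" "B \<subseteq> U" "S \<subseteq> U" using sub by auto
      then show ?thesis using disj d_separated_subgraph[OF sep subset_insertI] by (intro IH)
    next
      case 3
      \<comment> \<open>Without \<open>v\<close> in the conditioning set, one endpoint set is
        separated from the other enlarged by \<open>v\<close>. The case of an endpoint
        \<open>v\<close> applies to that, and weak union moves \<open>v\<close> back into the
        condition.\<close>
      define T where "T = S - {v}"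
      have S: "S = insert v T" and vT: "v \<notin> T" using 3 by (auto simp: T_def)
      have weak: "cmi h C D S = 0"
        if "C \<subseteq> insert v U" "D \<subseteq> insert v U" "C \<inter> D = {}" "C \<inter> S = {}" "D \<inter> S = {}"
          "d_separated ?F C (insert v D) T" for C D
      proof -
        have side: "C \<inter> insert v D = {}" "C \<inter> T = {}" "insert v D \<inter> T = {}" "T \<subseteq> insert v U"
          using that sub(3) vT S by auto
        then have "cmi h C (insert v D) T = 0" using that by (intro endpoint) auto
        moreover have "insert v D - {v} = D" "{v} \<union> T = S" using that S by auto
        moreover have "C \<subseteq> V" "insert v D \<subseteq> V" "T \<subseteq> V" using that side vV by auto
        ultimately show ?thesis
          using cmi_chain_eq_0[OF h, of C "insert v D" T "{v}"] side by auto
      qed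
      have "d_separated ?F A (insert v B) T \<or> d_separated ?F B (insert v A) T"
        using d_separated_remove_collider[OF sink, of A B T] sep S vT disj by blast
      then show ?thesis using weak[of A B] weak[of B A] sub disj cmi_sym[of h A B S] by (auto simp: Int_commute)
    qed
  qed
qed

section \<open>The local property between the other two\<close>

text \<open>An active walk from \<open>v\<close> cannot begin with a parent, which would be a
  non-collider in the conditioning set. Nor can it turn back, since the turning point would be both
  a descendant and a parent of \<open>v\<close>. So it ends at \<open>v\<close> or at a
  descendant.\<close>

lemma d_separated_local:
  assumes ac: "acyclic E" and v: "v \<in> V"
  shows "d_separated E {v} (nd V E v - pa E v) (pa E v)"
  unfolding d_separated_def
proof (intro allI impI notI, elim conjE)
  fix p assume p: "is_walk E p" "hd p \<in> {v}" "last p \<in> nd V E v - pa E v" "active_walk E (pa E v) p"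
  have ne: "p \<noteq> []" and p0: "p ! 0 = v" using p by (auto simp: is_walk_def hd_conv_nth)
  have step: "(p ! j, p ! Suc j) \<in> E \<or> (p ! Suc j, p ! j) \<in> E" if "Suc j < length p" for j
    using p(1) that unfolding is_walk_def successively_conv_nth by blast
  have act: "if collider_at E p i then p ! i \<in> pa E v else p ! i \<notin> pa E v" if "i < length p" for i
    using p(4) that unfolding active_walk_def by blast
  have asym: "(b, a) \<notin> E" if "(a, b) \<in> E\<^sup>+" for a b
    using ac that by (meson acyclic_def trancl_into_trancl)
  have fwd: "(v, p ! Suc i) \<in> E\<^sup>+ \<and> (p ! i, p ! Suc i) \<in> E" if "Suc i < length p" for i
    using that
  proof (induction i)
    case 0
    have "p ! 1 \<notin> pa E v"
    proof
      assume par: "p ! 1 \<in> pa E v"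
      then have "\<not> collider_at E p 1" using asym[of "p ! 1" v] p0 by (auto simp: collider_at_def pa_def)
      then show False using act[of 1] par 0 by auto
    qed
    then show ?case using step[of 0] 0 p0 by (auto simp: pa_def)
  next
    case (Suc i)
    then have IH: "(v, p ! Suc i) \<in> E\<^sup>+" "(p ! i, p ! Suc i) \<in> E" by auto
    have "(p ! Suc (Suc i), p ! Suc i) \<notin> E"
    proof
      assume "(p ! Suc (Suc i), p ! Suc i) \<in> E"
      then have "collider_at E p (Suc i)" using IH Suc.prems by (simp add: collider_at_def)
      then have "(p ! Suc i, v) \<in> E" using act[of "Suc i"] Suc.prems by (auto simp: pa_def)
      then show False using asym[OF IH(1)] by blast
    qed
    then have "(p ! Suc i, p ! Suc (Suc i)) \<in> E" using step[of "Suc i"] Suc.prems by blast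
    then show ?case using IH by (auto intro: trancl_into_trancl)
  qed
  show False
  proof (cases "length p = 1")
    case True
    then have "last p = v" using p0 ne by (simp add: last_conv_nth)
    then show False using p(3) by (simp add: nd_def)
  next
    case False
    then obtain i where i: "length p = Suc (Suc i)" using ne by (metis One_nat_def length_0_conv not0_implies_Suc)
    then have "(v, last p) \<in> E\<^sup>+" using fwd[of i] ne by (simp add: last_conv_nth)
    moreover have "last p \<noteq> v" using p(3) by (auto simp: nd_def)
    ultimately show False using p(3) by (auto simp: nd_def de_def)
  qed
qed

text \<open>A descendant of \<open>v\<close> comes after \<open>v\<close> in any topological
  ordering, hence not before it.\<close>

lemma pr_subset_nd:
  assumes r: "topological_ordering V E r"
  shows "pr r v \<subseteq> nd V E v"
proof -
  have "E\<^sup>+ \<subseteq> r"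
    using trancl_mono_subset[OF topological_ordering_arrows[OF r]] topological_ordering_trans[OF r]
    by (simp add: trancl_id)
  then show ?thesis
    using topological_ordering_irrefl[OF r] topological_ordering_trans[OF r] topological_ordering_field[OF r]
    unfolding pr_def nd_def de_def by (auto dest: transD)
qed

section \<open>Equivalence of the directed Markov properties\<close>

lemma q_indep_iff_cmi: "q_indep d V \<rho> A B C \<longleftrightarrow> cmi (entropy d V \<rho>) A B C = 0"
  by (simp add: q_indep_def cond_mutual_info_def cmi_def)

theorem theorem3p2:
  fixes V :: "'v set" and E :: "('v \<times> 'v) set" and d :: "'v \<Rightarrow> nat"
    and \<rho> :: "('v \<Rightarrow> nat) \<Rightarrow> ('v \<Rightarrow> nat) \<Rightarrow> complex"
  assumes "is_dag V E"
    and "\<rho> \<in> pos_states (cfg d V)"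
  shows "excess_global_info d V E \<rho> \<ge> 0
    \<and> (\<forall>r. topological_ordering V E r \<longrightarrow>
          (excess_global_info d V E \<rho> = 0 \<longleftrightarrow> ordered_markov d V E \<rho> r))
    \<and> (excess_global_info d V E \<rho> = 0 \<longleftrightarrow> local_markov d V E \<rho>)
    \<and> (excess_global_info d V E \<rho> = 0 \<longleftrightarrow> global_markov d V E \<rho>)"
proof -
  have fV: "finite V" and EV: "E \<subseteq> V \<times> V" and ac: "acyclic E"
    using assms(1) by (auto simp: is_dag_def)
  define h where "h = entropy d V \<rho>"
  have h0: "h {} = 0" unfolding h_def by (rule entropy_empty[OF fV assms(2)])
  have sm: "submodular_on V h"
    unfolding submodular_on_def h_def
    using strong_subadditivity[OF fV assms(2)]
    by (auto simp: cmi_def cond_mutual_info_def Int_commute)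
  have pa_V: "pa E v \<subseteq> V" for v using EV by (auto simp: pa_def)
  have pa_self: "v \<notin> pa E v" for v using ac by (auto simp: pa_def acyclic_def)
  \<comment> \<open>The left side does not mention \<open>r\<close>; this makes (O) for different
    orderings equivalent to the same condition.\<close>
  have excess: "excess_global_info d V E \<rho> = (\<Sum>v\<in>V. cmi h {v} (pr r v - pa E v) (pa E v))"
    if "topological_ordering V E r" for r
    unfolding excess_eq_sum_cmi[where h = h, OF fV that h0, symmetric]
    by (simp add: excess_global_info_def cond_entropy_def h_def)
  have nonneg: "cmi h {v} (pr r v - pa E v) (pa E v) \<ge> 0"
    if r: "topological_ordering V E r" and v: "v \<in> V" for r v
  proof -
    have "pr r v - pa E v \<subseteq> V" "v \<notin> pr r v"
      using pr_subset[OF r] topological_ordering_irrefl[OF r] by (auto simp: pr_def)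
    then show ?thesis
      using sm[unfolded submodular_on_def, rule_format, of "{v}" "pr r v - pa E v" "pa E v"]
        pa_V[of v] pa_self[of v] v by auto
  qed
  have O: "excess_global_info d V E \<rho> = 0 \<longleftrightarrow> ordered_markov d V E \<rho> r"
    if r: "topological_ordering V E r" for r
    unfolding excess[OF r] ordered_markov_def q_indep_iff_cmi h_def[symmetric]
    using fV nonneg[OF r] by (simp add: sum_nonneg_eq_0_iff)
  \<comment> \<open>One ordering closes the cycle from (O) to (G) to (L) and back; every other
    ordering is reached through the vanishing of the excess.\<close>
  obtain r where r: "topological_ordering V E r"
    using ex_topological_ordering[OF assms(1)] .
  have OG: "global_markov d V E \<rho>" if "ordered_markov d V E \<rho> r"
  proof -
    have "E \<inter> V \<times> V = E" using EV by blast
    then show ?thesis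
      using ordered_imp_global[OF sm fV r] that
      unfolding global_markov_def ordered_markov_def q_indep_iff_cmi h_def[symmetric] by simp
  qed
  have GL: "local_markov d V E \<rho>" if G: "global_markov d V E \<rho>"
    unfolding local_markov_def
  proof
    fix v assume v: "v \<in> V"
    have "nd V E v - pa E v \<subseteq> V" "v \<notin> nd V E v" by (auto simp: nd_def)
    then show "q_indep d V \<rho> {v} (nd V E v - pa E v) (pa E v)"
      using G[unfolded global_markov_def, rule_format, of "{v}" "nd V E v - pa E v" "pa E v"]
        d_separated_local[OF ac v] v pa_V[of v] pa_self[of v] by auto
  qed
  have LO: "ordered_markov d V E \<rho> r" if L: "local_markov d V E \<rho>"
    unfolding ordered_markov_def q_indep_iff_cmi h_def[symmetric]
  proof
    fix v assume v: "v \<in> V"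
    have nd: "nd V E v - pa E v \<subseteq> V" "v \<notin> nd V E v" by (auto simp: nd_def)
    have "cmi h {v} (nd V E v - pa E v) (pa E v) = 0"
      using L v unfolding local_markov_def q_indep_iff_cmi h_def by blast
    \<comment> \<open>Predecessors are nondescendants, so decomposition yields the ordered
      statement.\<close>
    moreover have "pr r v - pa E v \<subseteq> nd V E v - pa E v"
      using pr_subset_nd[OF r] by blast
    moreover have "(nd V E v - pa E v) \<inter> pa E v = {}" by blast
    ultimately show "cmi h {v} (pr r v - pa E v) (pa E v) = 0"
      using cmi_chain_eq_0[OF sm, of "{v}" "nd V E v - pa E v" "pa E v" "pr r v - pa E v"]
        nd v pa_V[of v] pa_self[of v] by simp
  qed
  have "excess_global_info d V E \<rho> \<ge> 0"
    unfolding excess[OF r] using nonneg[OF r] by (rule sum_nonneg)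
  then show ?thesis using O O[OF r] OG GL LO by blast
qed

end
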